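(* Let $n\ge 3$, $0<m<\frac{n-2}{n}$, $\beta>\beta_0(m)$ and $\alpha=\frac{2\beta+1}{1-m}$. For any $\lambda>0$ let $f_\lambda$ be the unique radially symmetric solution of $$\Delta f^m+\alpha f+\beta\, y\cdot\nabla f=0,\quad f>0\ \text{ in }\mathbb{R}^n,\qquad f(0)=\lambda^{\frac{2}{1-m}},$$ written as $f_\lambda(r)$, $r=|y|$. Then the following holds. (a) If either (i) $n\ge 3$, $0<m<\frac{n-2}{n}$ and $\beta>\beta_1(m)$, or (ii) $n>4$, $0<m<\frac{n-4}{n-2}$ and $\beta_0(m)<\beta\le\beta_1(m)$, then there exists a constant $B>0$ such that for any $\lambda>0$, $$f_\lambda(r)=\left(\frac{C_*}{r^2}\right)^{\frac{1}{1-m}}\left\{1-B_\lambda r^{-\gamma}+o(r^{-\gamma})\right\}\quad\text{as } r\to\infty$$ with $\gamma=\gamma_1(m,\beta)$ and $B_\lambda=B\lambda^{-\gamma}$. (b) If either (i) $3\le n\le 4$, $0<m<\frac{n-2}{n}$ and $\beta_0(m)<\beta<\beta_1(m)$, or (ii) $n>4$, $\frac{n-4}{n-2}<m<\frac{n-2}{n}$ and $\beta_0(m)<\beta<\beta_1(m)$, then there exists a constant $B>0$ such that for any $\lambda>0$, $$f_\lambda(r)=\left(\frac{C_*}{r^2}\right)^{\frac{1}{1-m}}\left\{1+B_\lambda r^{-\gamma}+o(r^{-\gamma})\right\}\quad\text{as } r\to\infty$$ with $\gamma=\gamma_1(m,\beta)$ and $B_\lambda=B\lambda^{-\gamma}$.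 (c) If either (i) $3\le n\le 4$, $0<m<\frac{n-2}{n}$ and $\beta=\beta_1(m)$, or (ii) $n>4$, $\frac{n-4}{n-2}<m<\frac{n-2}{n}$ and $\beta=\beta_1(m)$, then there exists a constant $B>0$ such that for any $\lambda>0$, $$f_\lambda(r)=\left(\frac{C_*}{r^2}\right)^{\frac{1}{1-m}}\left\{1-B_\lambda r^{-\gamma}+o(r^{-\gamma})\right\}\quad\text{as } r\to\infty$$ with $\gamma=\gamma_2(m,\beta_1(m))=2$ and $B_\lambda=B\lambda^{-2}$. In this case $$f_\lambda(y)=\left(\frac{C_*}{k^2+|y|^2}\right)^{\frac{1}{1-m}}\quad\text{with } k=\sqrt{C_*}/\lambda.$$
   Context: For $n\ge3$ and $0<m<\frac{n-2}{n}$ define $$\beta_1(m)=\frac{1}{n-2-nm},\quad \beta_e(m)=\frac{m}{n-2-nm},\quad \beta_2(m)=\sqrt{\frac{2(1-m)}{n-2-nm}}+\frac{(n+2)m-(n-2)}{2(n-2-nm)},$$ $$\beta_0(m)=\max(\beta_2(m),\beta_e(m)),\qquad C_*=\frac{2m(n-2-nm)}{1-m}.$$ Let $A_0(m,\beta)=n-2-(n+2)m+2\beta(n-2-nm)$. For $\beta\ge\beta_0(m)$ the numbers $$\gamma_j(m,\beta)=\frac{1}{2(1-m)}\left\{A_0(m,\beta)+(-1)^j\sqrt{A_0(m,\beta)^2-8(n-2-nm)(1-m)}\right\},\quad j=1,2,$$ are the two positive roots ($\gamma_2\ge\gamma_1>0$, and $\gamma_2>\gamma_1$ if $\beta>\beta_0(m)$)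 of $\gamma^2-\frac{A_0(m,\beta)}{1-m}\gamma+\frac{2(n-2-nm)}{1-m}=0$. For $\beta\ge\beta_e(m)$ and $\alpha=\frac{2\beta+1}{1-m}$, existence and uniqueness of the radially symmetric solution $f_\lambda$ of the elliptic problem is a known result for every $\lambda>0$, and it is known that $\lim_{r\to\infty}r^2f_\lambda^{1-m}(r)=C_*$. *)

theory Defs
  imports "HOL-Analysis.Analysis" "HOL-Library.Landau_Symbols"
begin

definition partial_deriv :: "'n::finite \<Rightarrow> (real ^ 'n \<Rightarrow> real) \<Rightarrow> real ^ 'n \<Rightarrow> real" where
  "partial_deriv i u y = frechet_derivative u (at y) (axis i 1)"

definition C2 :: "(real ^ 'n::finite \<Rightarrow> real) \<Rightarrow> bool" where
  "C2 u \<longleftrightarrow>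
     (\<forall>y. u differentiable (at y)) \<and>
     (\<forall>i y. partial_deriv i u differentiable (at y)) \<and>
     (\<forall>i j. continuous_on UNIV (partial_deriv i (partial_deriv j u)))"

definition laplacian :: "(real ^ 'n::finite \<Rightarrow> real) \<Rightarrow> real ^ 'n \<Rightarrow> real" where
  "laplacian u y = (\<Sum>i\<in>UNIV. partial_deriv i (partial_deriv i u) y)"

definition gradient :: "(real ^ 'n::finite \<Rightarrow> real) \<Rightarrow> real ^ 'n \<Rightarrow> real ^ 'n" where
  "gradient u y = (\<chi> i. partial_deriv i u y)"

text \<open>Solutions are classical. Since \<open>u\<close> is positive, \<open>u powr m\<close> is twice continuously
  differentiable whenever \<open>u\<close> is.\<close>

definition elliptic_solution ::
  "real \<Rightarrow> real \<Rightarrow> real \<Rightarrow> (real ^ 'n::finite \<Rightarrow> real) \<Rightarrow> bool" where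
  "elliptic_solution m \<alpha> \<beta> u \<longleftrightarrow>
     C2 u \<and> (\<forall>y. u y > 0) \<and>
     (\<forall>y. laplacian (\<lambda>z. u z powr m) y + \<alpha> * u y + \<beta> * (y \<bullet> gradient u y) = 0)"

text \<open>A radially symmetric solution is represented by its profile \<open>f\<close>, a function of
  \<open>r = norm y\<close> (the values of \<open>f\<close> at negative \<open>r\<close> are irrelevant). The type argument fixes the
  space \<open>real ^ 'n\<close> on which the equation is posed.\<close>

definition radial_solution ::
  "'n::finite itself \<Rightarrow> real \<Rightarrow> real \<Rightarrow> real \<Rightarrow> real \<Rightarrow> (real \<Rightarrow> real) \<Rightarrow> bool" where
  "radial_solution _ m \<alpha> \<beta> lam f \<longleftrightarrow>
     elliptic_solution m \<alpha> \<beta> (\<lambda>y :: real ^ 'n. f (norm y)) \<and> f 0 = lam powr (2 / (1 - m))"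

definition beta1 :: "nat \<Rightarrow> real \<Rightarrow> real" where
  "beta1 n m = 1 / (real n - 2 - real n * m)"

definition beta_e :: "nat \<Rightarrow> real \<Rightarrow> real" where
  "beta_e n m = m / (real n - 2 - real n * m)"

definition beta2 :: "nat \<Rightarrow> real \<Rightarrow> real" where
  "beta2 n m = sqrt (2 * (1 - m) / (real n - 2 - real n * m))
     + ((real n + 2) * m - (real n - 2)) / (2 * (real n - 2 - real n * m))"

definition beta0 :: "nat \<Rightarrow> real \<Rightarrow> real" where
  "beta0 n m = max (beta2 n m) (beta_e n m)"

definition C_star :: "nat \<Rightarrow> real \<Rightarrow> real" where
  "C_star n m = 2 * m * (real n - 2 - real n * m) / (1 - m)"

definition A0 :: "nat \<Rightarrow> real \<Rightarrow> real \<Rightarrow> real" where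
  "A0 n m \<beta> = real n - 2 - (real n + 2) * m + 2 * \<beta> * (real n - 2 - real n * m)"

definition gamma_exp :: "nat \<Rightarrow> nat \<Rightarrow> real \<Rightarrow> real \<Rightarrow> real" where
  "gamma_exp j n m \<beta> = 1 / (2 * (1 - m)) *
     (A0 n m \<beta> + (-1) ^ j * sqrt ((A0 n m \<beta>)\<^sup>2 - 8 * (real n - 2 - real n * m) * (1 - m)))"

text \<open>\<open>f r = (C\<^sub>* / r\<^sup>2) powr (1 / (1 - m)) * (1 + b * r powr - \<gamma> + o(r powr - \<gamma>))\<close>
  as \<open>r\<close> tends to infinity; the coefficient \<open>b\<close> carries its sign.\<close>

definition decay_expansion :: "nat \<Rightarrow> real \<Rightarrow> real \<Rightarrow> real \<Rightarrow> (real \<Rightarrow> real) \<Rightarrow> bool" where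
  "decay_expansion n m \<gamma> b f \<longleftrightarrow>
     (\<exists>h. h \<in> o[at_top](\<lambda>r. r powr (- \<gamma>)) \<and>
       (\<forall>\<^sub>F r in at_top.
          f r = (C_star n m / r\<^sup>2) powr (1 / (1 - m)) * (1 + b * r powr (- \<gamma>) + h r)))"

end

theory Submission
  imports Defs
begin

text \<open>In the variable \<open>s = ln r\<close> the radial equation becomes a planar quadratic autonomous system
  for \<open>x = r\<^sup>2 f powr (1 - m) / C\<^sub>*\<close> and \<open>\<zeta> = (ln x)' / 2\<close>. The solution \<open>f\<^sub>\<lambda>\<close> is the orbit
  leaving the saddle \<open>(0, 1)\<close>, and \<open>\<lambda>\<close> only translates it in \<open>s\<close>. The point \<open>(1, 0)\<close> is a stable
  node with rates \<open>\<gamma>\<^sub>1 < \<gamma>\<^sub>2\<close>. For \<open>\<beta> = \<beta>\<^sub>1\<close> the orbit is the segment \<open>\<zeta> = 1 - x\<close>, which gives the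
  explicit solution; for other \<open>\<beta>\<close> it stays below (\<open>\<beta> > \<beta>\<^sub>1\<close>) or above (\<open>\<beta> < \<beta>\<^sub>1\<close>) this segment as
  long as \<open>\<zeta> > 0\<close>. The segment has slope \<open>2\<close> measured in exponents, so comparing \<open>2\<close> with
  \<open>\<gamma>\<^sub>1, \<gamma>\<^sub>2\<close> and using a line through \<open>(1, 0)\<close> of slope strictly between \<open>\<gamma>\<^sub>1\<close> and \<open>\<gamma>\<^sub>2\<close> as a barrier
  shows that the orbit enters the node from \<open>x < 1\<close> or, after overshooting once, from \<open>x > 1\<close>, and
  that it avoids the fast direction. Hence \<open>\<bar>1 - x\<bar> * exp (\<gamma>\<^sub>1 s)\<close> has a positive limit.\<close>

section \<open>Real functions of one variable\<close>

lemma first_zero: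
  fixes g :: "real \<Rightarrow> real"
  assumes cont: "continuous_on {a..b} g" and "a \<le> b" "g a > 0" "g b \<le> 0"
  obtains t where "a < t" "t \<le> b" "g t = 0" "\<And>r. a \<le> r \<Longrightarrow> r < t \<Longrightarrow> g r > 0"
proof -
  let ?S = "{a..b} \<inter> g -` {..0}"
  have "closed ?S" by (rule continuous_closed_preimage[OF cont]) auto
  then have "compact ?S"
    by (metis Int_lower1 bounded_closed_interval bounded_subset compact_eq_bounded_closed)
  moreover have "b \<in> ?S" using assms by auto
  ultimately obtain t where t: "t \<in> ?S" "\<And>r. r \<in> ?S \<Longrightarrow> t \<le> r"
    using compact_attains_inf[of ?S] by blast
  have pos: "g r > 0" if "a \<le> r" "r < t" for r
  proof (rule ccontr)
    assume "\<not> g r > 0"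
    then have "r \<in> ?S" using that t(1) by auto
    then show False using t(2)[of r] that by linarith
  qed
  have "a \<noteq> t" using t(1) assms(3) by auto
  then have "a < t" using t(1) by simp
  have "g t = 0"
  proof (rule ccontr)
    assume "g t \<noteq> 0"
    then have "g t < 0" using t by auto
    moreover have "continuous_on {a..t} g" using cont t by (auto intro: continuous_on_subset)
    ultimately obtain r where "a \<le> r" "r \<le> t" "g r = 0"
      using IVT2'[of g t 0 a] assms(3) \<open>a < t\<close> by force
    then show False using pos[of r] \<open>g t < 0\<close> by (cases "r = t") auto
  qed
  then show ?thesis using that[of t] \<open>a < t\<close> t pos by auto
qed

text \<open>Orbits are prescribed at minus infinity, so first contacts with a barrier are sought on
  a half-line. Eventual positivity supplies the left end of a compact interval.\<close>

lemma first_zero_at_bot: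
  fixes g :: "real \<Rightarrow> real"
  assumes cont: "continuous_on UNIV g" and "eventually (\<lambda>s. g s > 0) at_bot" "g b \<le> 0"
  obtains t where "t \<le> b" "g t = 0" "\<And>r. r < t \<Longrightarrow> g r > 0"
proof -
  obtain a0 where a0: "\<And>s. s \<le> a0 \<Longrightarrow> g s > 0"
    using assms(2) by (auto simp: eventually_at_bot_linorder)
  define a where "a = min a0 b"
  have "continuous_on {a..b} g" using cont continuous_on_subset by blast
  moreover have "a \<le> b" "g a > 0" using a0[of a] by (auto simp: a_def)
  ultimately obtain t where t: "a < t" "t \<le> b" "g t = 0"
      "\<And>r. a \<le> r \<Longrightarrow> r < t \<Longrightarrow> g r > 0"
    using first_zero assms(3) by metis
  have "g r > 0" if "r < t" for r
    using t(4)[of r] a0[of r] that by (cases "a \<le> r") (auto simp: a_def)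
  then show ?thesis using that t by blast
qed

text \<open>Contradicts a strict sign of the vector field on a barrier, and so excludes a first
  contact with it.\<close>

lemma deriv_nonpos_at_first_zero:
  fixes g :: "real \<Rightarrow> real"
  assumes "(g has_real_derivative D) (at t)" "g t = 0" "a < t" "\<And>r. a \<le> r \<Longrightarrow> r < t \<Longrightarrow> g r > 0"
  shows "D \<le> 0"
proof (rule ccontr)
  assume "\<not> D \<le> 0"
  then obtain e where e: "e > 0" "\<And>h. 0 < h \<Longrightarrow> h < e \<Longrightarrow> g (t - h) < g t"
    using has_real_derivative_pos_inc_left[of g D t UNIV] assms(1) by auto
  define h where "h = min (e/2) (t - a)"
  have "0 < h" "h < e" "h \<le> t - a" using e(1) assms(3) by (auto simp: h_def)
  then show False using e(2)[of h] assms(2) assms(4)[of "t - h"] by auto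
qed

text \<open>Monotonicity turns the limit 0 into \<open>g (b - 1) \<ge> 0\<close>; the last unit
  interval makes the inequality strict.\<close>

lemma deriv_pos_at_bot_imp_pos:
  fixes g :: "real \<Rightarrow> real"
  assumes "(g \<longlongrightarrow> 0) at_bot" "\<And>s. s \<le> b \<Longrightarrow> (g has_real_derivative g' s) (at s)"
    and "\<And>s. s < b \<Longrightarrow> g' s > 0"
  shows "g b > 0"
proof -
  have mono: "g s < g t" if "s < t" "t \<le> b" for s t
  proof (rule DERIV_pos_imp_increasing_open[OF \<open>s < t\<close>])
    show "\<exists>y. (g has_real_derivative y) (at r) \<and> y > 0" if "s < r" "r < t" for r
      using assms(2,3)[of r] that \<open>t \<le> b\<close> by force
    show "continuous_on {s..t} g"
      using DERIV_isCont[OF assms(2)] that by (intro continuous_at_imp_continuous_on) auto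
  qed
  have "g (b - 1) \<ge> 0"
    using assms(1)
  proof (rule tendsto_upperbound)
    show "eventually (\<lambda>s. g s \<le> g (b - 1)) at_bot"
      using eventually_le_at_bot[of "b - 1"] by eventually_elim (use mono in \<open>force simp: le_less\<close>)
  qed simp
  then show ?thesis using mono[of "b-1" b] by auto
qed

lemma deriv_zero_at_bot_imp_zero:
  fixes g :: "real \<Rightarrow> real"
  assumes "(g \<longlongrightarrow> 0) at_bot" "\<And>s. (g has_real_derivative 0) (at s)"
  shows "g b = 0"
proof -
  have "g s = g b" for s using DERIV_isconst_all[of g s b] assms(2) by auto
  then have "(g \<longlongrightarrow> g b) at_bot" by (intro tendsto_eventually always_eventually) blast
  then show ?thesis using tendsto_unique[OF _ assms(1)] by force
qed

lemma bounded_atMost_of_tendsto_at_bot: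
  fixes g :: "real \<Rightarrow> real"
  assumes "(g \<longlongrightarrow> l) at_bot" "continuous_on UNIV g"
  obtains K where "K > 0" "\<And>s. s \<le> T \<Longrightarrow> \<bar>g s\<bar> \<le> K"
proof -
  have "eventually (\<lambda>s. dist (g s) l < 1) at_bot" using assms(1) by (rule tendstoD) simp
  then obtain a where a: "\<And>s. s \<le> a \<Longrightarrow> dist (g s) l < 1"
    by (auto simp: eventually_at_bot_linorder)
  have "compact (g ` {a..T})"
    by (rule compact_continuous_image) (auto intro: continuous_on_subset[OF assms(2)])
  then obtain C where C: "\<And>s. s \<in> {a..T} \<Longrightarrow> \<bar>g s\<bar> \<le> C"
    using compact_imp_bounded bounded_iff by (metis imageI real_norm_def)
  show ?thesis
  proof (rule that[of "max (\<bar>l\<bar> + 1) C"])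
    show "\<bar>g s\<bar> \<le> max (\<bar>l\<bar> + 1) C" if "s \<le> T" for s
      using a[of s] C[of s] that by (cases "s \<le> a") (auto simp: dist_real_def)
  qed auto
qed

text \<open>With \<open>e\<close> an antiderivative of minus the bound, \<open>g + e\<close> is
  nonincreasing and \<open>g - e\<close> is nondecreasing; since \<open>e\<close> tends to 0,
  \<open>g\<close> is squeezed to a limit.\<close>

lemma convergent_at_top_of_deriv_exp_bound:
  fixes g :: "real \<Rightarrow> real"
  assumes der: "\<And>s. s \<ge> a \<Longrightarrow> (g has_real_derivative g' s) (at s)"
    and bound: "\<And>s. s \<ge> a \<Longrightarrow> \<bar>g' s\<bar> \<le> C * exp (- k * s)" and "k > 0"
  obtains l where "(g \<longlongrightarrow> l) at_top"
proof -
  have C: "C \<ge> 0"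
  proof -
    have "0 \<le> C * exp (- k * a)" using bound[of a] by linarith
    then show ?thesis by (simp add: zero_le_mult_iff)
  qed
  define e where "e s = C / k * exp (- k * s)" for s
  have de: "(e has_real_derivative - C * exp (- k * s)) (at s)" for s
    unfolding e_def using \<open>k > 0\<close> by (auto intro!: derivative_eq_intros)
  have e0: "e s \<ge> 0" for s using C \<open>k > 0\<close> by (simp add: e_def)
  have elim: "(e \<longlongrightarrow> 0) at_top"
  proof -
    have "filterlim (\<lambda>s. - k * s) at_bot at_top"
      using \<open>k > 0\<close> by (intro filterlim_tendsto_neg_mult_at_bot[OF tendsto_const]) (auto simp: filterlim_ident)
    then have "((\<lambda>s. C / k * exp (- k * s)) \<longlongrightarrow> C / k * 0) at_top"
      by (intro tendsto_intros filterlim_compose[OF exp_at_bot])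
    then show ?thesis by (simp add: e_def[abs_def])
  qed
  have dec: "g t + e t \<le> g s + e s" if "a \<le> s" "s \<le> t" for s t
  proof (rule DERIV_nonpos_imp_nonincreasing[OF \<open>s \<le> t\<close>])
    show "\<exists>y. ((\<lambda>s. g s + e s) has_real_derivative y) (at x) \<and> y \<le> 0" if "s \<le> x" "x \<le> t" for x
      using DERIV_add[OF der[of x] de[of x]] bound[of x] that \<open>a \<le> s\<close>
      by (intro exI[of _ "g' x + - C * exp (- k * x)"]) (auto simp: abs_le_iff)
  qed
  have inc: "g s - e s \<le> g t - e t" if "a \<le> s" "s \<le> t" for s t
  proof (rule DERIV_nonneg_imp_nondecreasing[OF \<open>s \<le> t\<close>])
    show "\<exists>y. ((\<lambda>s. g s - e s) has_real_derivative y) (at x) \<and> 0 \<le> y" if "s \<le> x" "x \<le> t" for x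
      using DERIV_diff[OF der[of x] de[of x]] bound[of x] that \<open>a \<le> s\<close>
      by (intro exI[of _ "g' x - - C * exp (- k * x)"]) (auto simp: abs_le_iff)
  qed
  \<comment> \<open>Freezing the argument below \<open>a\<close> gives a function monotone on the
    whole line, for which a limit along the integers is a limit at infinity.\<close>
  define h where "h s = g (max a s) - e (max a s)" for s
  have "mono h" unfolding h_def by (auto intro!: monoI inc)
  moreover have hb: "h s \<le> g a + e a" for s
    using dec[of a "max a s"] e0[of "max a s"] by (simp add: h_def)
  ultimately have "incseq (\<lambda>n. h (real n))" by (auto simp: incseq_def mono_def)
  then obtain l where "(\<lambda>n. h (real n)) \<longlonglongrightarrow> l"
    using incseq_convergent[of "\<lambda>n. h (real n)" "g a + e a"] hb by blast
  then have l: "(h \<longlongrightarrow> l) at_top"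
    using tendsto_at_topI_sequentially_real[of h l] \<open>mono h\<close> by blast
  have "((\<lambda>s. h s + e s) \<longlongrightarrow> l + 0) at_top" by (intro tendsto_intros l elim)
  moreover have "eventually (\<lambda>s. h s + e s = g s) at_top"
    using eventually_ge_at_top[of a] by eventually_elim (auto simp: h_def max_def)
  ultimately have "(g \<longlongrightarrow> l + 0) at_top" by (rule Lim_transform_eventually)
  then show ?thesis by (rule that)
qed

lemma unbounded_of_deriv_ge:
  fixes g :: "real \<Rightarrow> real"
  assumes "\<And>s. s \<ge> a \<Longrightarrow> (g has_real_derivative g' s) (at s)" "\<And>s. s \<ge> a \<Longrightarrow> g' s \<ge> k" "k > 0"
  shows "\<exists>s\<ge>a. g s > b"
proof -
  have *: "g a - k * a \<le> g s - k * s" if "a \<le> s" for s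
  proof (rule DERIV_nonneg_imp_nondecreasing[OF that])
    fix r assume "a \<le> r"
    then show "\<exists>y. ((\<lambda>s. g s - k * s) has_real_derivative y) (at r) \<and> 0 \<le> y"
      using assms(2)[of r] by (intro exI[of _ "g' r - k"]) (auto intro!: derivative_eq_intros assms(1))
  qed
  define s where "s = a + (\<bar>b - g a\<bar> + 1) / k"
  have "k * (s - a) = \<bar>b - g a\<bar> + 1" using assms(3) by (simp add: s_def)
  moreover have "s \<ge> a" using assms(3) by (simp add: s_def)
  ultimately show ?thesis using *[of s] by (intro exI[of _ s]) (auto simp: algebra_simps)
qed

section \<open>The planar system\<close>

text \<open>With \<open>r = exp s\<close>, the unknowns are \<open>x = r\<^sup>2 f powr (1 - m) / C\<^sub>*\<close> and
  \<open>\<zeta> = 1 + (1 - m) / 2 * r f' / f\<close>, that is \<open>x' = 2 x \<zeta>\<close>; the parameters are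
  \<open>p = 2 m / (1 - m)\<close>, \<open>d = (n - 2 - n m) / (1 - m)\<close> and \<open>\<kappa> = 2 \<beta> d\<close>, and \<open>x0\<close> is
  \<open>\<lambda>\<^sup>2 / C\<^sub>*\<close>. The conditions at \<open>-\<infinity>\<close> select the orbit leaving the saddle \<open>(0, 1)\<close>,
  which is to be followed to \<open>(1, 0)\<close>. In these terms \<open>\<beta> = \<beta>\<^sub>1\<close> reads \<open>\<kappa> = p + 2\<close>.\<close>

locale profile_system =
  fixes p d \<kappa> x0 :: real and x \<zeta> :: "real \<Rightarrow> real"
  assumes p_pos: "0 < p" and d_pos: "0 < d" and kappa_pos: "0 < \<kappa>" and x0_pos: "0 < x0"
    and x_pos: "\<And>s. x s > 0"
    and x_deriv: "\<And>s. (x has_real_derivative 2 * x s * \<zeta> s) (at s)"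
    and zeta_deriv: "\<And>s. (\<zeta> has_real_derivative
          (1 - \<zeta> s) * (p * \<zeta> s + d) - x s * (d + \<kappa> * \<zeta> s)) (at s)"
    and x_start: "((\<lambda>s. x s * exp (- 2 * s)) \<longlongrightarrow> x0) at_bot"
    and zeta_start: "((\<lambda>s. (\<zeta> s - 1) * exp (- s)) \<longlongrightarrow> 0) at_bot"
begin

section \<open>Continuity and limits at the saddle\<close>

lemma x_cont: "continuous_on A x" and zeta_cont: "continuous_on A \<zeta>"
  using DERIV_isCont[OF x_deriv] DERIV_isCont[OF zeta_deriv]
  by (auto intro: continuous_at_imp_continuous_on)

lemma x_tendsto_at_bot: "(x \<longlongrightarrow> 0) at_bot"
proof -
  have "((\<lambda>s::real. exp s) \<longlongrightarrow> 0) at_bot" by (rule exp_at_bot)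
  then have "((\<lambda>s. x s * exp (- 2 * s) * (exp s * exp s)) \<longlongrightarrow> x0 * (0 * 0)) at_bot"
    by (intro tendsto_mult x_start)
  moreover have "(\<lambda>s. x s * exp (- 2 * s) * (exp s * exp s)) = x"
    by (simp add: fun_eq_iff mult.assoc flip: exp_add)
  ultimately show ?thesis by simp
qed

lemma zeta_tendsto_at_bot: "(\<zeta> \<longlongrightarrow> 1) at_bot"
proof -
  have "((\<lambda>s::real. exp s) \<longlongrightarrow> 0) at_bot" by (rule exp_at_bot)
  then have "((\<lambda>s. 1 + (\<zeta> s - 1) * exp (- s) * exp s) \<longlongrightarrow> 1 + 0 * 0) at_bot"
    by (intro tendsto_intros zeta_start)
  moreover have "1 + (\<zeta> s - 1) * exp (- s) * exp s = \<zeta> s" for s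
    by (simp add: mult.assoc flip: exp_add)
  ultimately show ?thesis by simp
qed

text \<open>The distance \<open>\<zeta> - (1 - x)\<close> to the segment joining the two rest points satisfies a
  linear equation; \<open>\<Lambda>\<close> is this distance times the integrating factor, explicit because
  \<open>\<zeta> = (ln x)' / 2\<close>.\<close>

definition \<Lambda> :: "real \<Rightarrow> real" where
  "\<Lambda> s = (\<zeta> s - (1 - x s)) * exp (p / 2 * ln (x s) + d * s)"

text \<open>For \<open>D = \<zeta> - (1 - x)\<close>, inserting \<open>1 - \<zeta> = x - D\<close>
  gives \<open>D' = (p + 2 - \<kappa>) * x * \<zeta> - (p * \<zeta> + d) * D\<close>. The exponent
  in \<open>\<Lambda>\<close> has derivative \<open>p * \<zeta> + d\<close>, so only the source term
  survives.\<close>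

lemma \<Lambda>_deriv:
  "(\<Lambda> has_real_derivative
     (p + 2 - \<kappa>) * x s * \<zeta> s * exp (p / 2 * ln (x s) + d * s)) (at s)"
  unfolding \<Lambda>_def using x_pos[of s]
  by (auto intro!: derivative_eq_intros x_deriv zeta_deriv simp: field_simps)

lemma \<Lambda>_tendsto_at_bot: "(\<Lambda> \<longlongrightarrow> 0) at_bot"
proof -
  have "((\<lambda>s. \<zeta> s - (1 - x s)) \<longlongrightarrow> 1 - (1 - 0)) at_bot"
    by (intro tendsto_intros zeta_tendsto_at_bot x_tendsto_at_bot)
  then have lim: "((\<lambda>s. \<zeta> s - (1 - x s)) \<longlongrightarrow> 0) at_bot" by simp
  have "eventually (\<lambda>s. x s < 1) at_bot"
    using x_tendsto_at_bot by (rule order_tendstoD) simp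
  then have "eventually (\<lambda>s. norm (\<Lambda> s) \<le> norm (\<zeta> s - (1 - x s))) at_bot"
    using eventually_le_at_bot[of 0]
  proof eventually_elim
    case (elim s)
    have "p / 2 * ln (x s) \<le> 0" "d * s \<le> 0"
      using elim x_pos[of s] p_pos d_pos by (auto simp: mult_le_0_iff)
    then show ?case by (simp add: \<Lambda>_def abs_mult mult_left_le)
  qed
  then show ?thesis by (rule Lim_transform_bound[OF _ lim])
qed

text \<open>While \<open>\<zeta>\<close> is positive, the derivative of \<open>\<Lambda>\<close> has
  the sign of \<open>p + 2 - \<kappa>\<close>. As \<open>\<Lambda>\<close> starts from 0, this sign
  decides the side of the segment.\<close>

lemma line_above:
  assumes "\<kappa> < p + 2" "\<And>t. t < s \<Longrightarrow> \<zeta> t > 0"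
  shows "\<zeta> s > 1 - x s"
proof -
  have "\<Lambda> s > 0"
    by (rule deriv_pos_at_bot_imp_pos[OF \<Lambda>_tendsto_at_bot \<Lambda>_deriv]) (use assms x_pos in auto)
  then show ?thesis by (simp add: \<Lambda>_def zero_less_mult_iff)
qed

lemma line_below:
  assumes "\<kappa> > p + 2" "\<And>t. t < s \<Longrightarrow> \<zeta> t > 0"
  shows "\<zeta> s < 1 - x s"
proof -
  have "((\<lambda>s. - \<Lambda> s) \<longlongrightarrow> 0) at_bot" using tendsto_minus[OF \<Lambda>_tendsto_at_bot] by simp
  then have "- \<Lambda> s > 0"
    by (rule deriv_pos_at_bot_imp_pos[OF _ DERIV_minus[OF \<Lambda>_deriv]])
       (use assms x_pos in \<open>auto simp: mult_neg_pos mult_less_0_iff\<close>)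
  then show ?thesis by (simp add: \<Lambda>_def mult_less_0_iff)
qed

lemma line_eq:
  assumes "\<kappa> = p + 2"
  shows "\<zeta> s = 1 - x s"
proof -
  have "\<Lambda> s = 0"
    by (rule deriv_zero_at_bot_imp_zero[OF \<Lambda>_tendsto_at_bot]) (use \<Lambda>_deriv assms in auto)
  then show ?thesis by (simp add: \<Lambda>_def)
qed

lemma line_above_weak:
  assumes "\<kappa> \<le> p + 2" "\<And>t. t < s \<Longrightarrow> \<zeta> t > 0"
  shows "\<zeta> s \<ge> 1 - x s"
  using line_above[of s] line_eq[of s] assms by force

text \<open>On the segment \<open>x' = 2 * x * (1 - x)\<close> is a logistic equation with first
  integral \<open>(1 / x - 1) * exp (2 * s)\<close>, whose value \<open>1 / x0\<close> is read off
  at minus infinity.\<close>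

lemma explicit_solution:
  assumes "\<kappa> = p + 2"
  shows "x s = x0 * exp (2 * s) / (1 + x0 * exp (2 * s))"
proof -
  define g where "g s = (1 / x s - 1) * exp (2 * s)" for s
  have "(g has_real_derivative 0) (at s)" for s
    unfolding g_def[abs_def] using x_pos[of s]
    by (auto intro!: derivative_eq_intros x_deriv simp: line_eq[OF assms, of s] field_simps)
  then have "g t = g s" for t using DERIV_isconst_all[of g t s] by blast
  then have 1: "(g \<longlongrightarrow> g s) at_bot" by (intro tendsto_eventually always_eventually) blast
  have "((\<lambda>s. inverse (x s * exp (- 2 * s)) - exp s * exp s) \<longlongrightarrow> inverse x0 - 0 * 0) at_bot"
    using x0_pos by (intro tendsto_intros x_start exp_at_bot) auto
  moreover have "(\<lambda>s. inverse (x s * exp (- 2 * s)) - exp s * exp s) = g"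
    by (auto simp: g_def fun_eq_iff exp_minus divide_simps algebra_simps simp flip: exp_add mult_2)
  ultimately have "(g \<longlongrightarrow> inverse x0) at_bot" by simp
  then have "g s = inverse x0" using tendsto_unique[OF _ 1] by force
  then have "x s * (1 + x0 * exp (2 * s)) = x0 * exp (2 * s)"
    using x_pos[of s] x0_pos by (auto simp: g_def field_simps)
  moreover have "1 + x0 * exp (2 * s) \<noteq> 0" using x0_pos by (smt (verit) exp_gt_zero mult_pos_pos)
  ultimately show ?thesis by (simp add: eq_divide_eq)
qed

end

section \<open>Decay rate at the node\<close>

context profile_system
begin

text \<open>Minus the slope of the line from the node (1, 0) to the orbit point. The eigendirections
  are constant values of \<open>\<rho>\<close>, so its limit tells slow from fast approach.\<close>

definition \<rho> :: "real \<Rightarrow> real" where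
  "\<rho> s = \<zeta> s / (1 - x s)"

lemma zeta_eq_rho: "x s \<noteq> 1 \<Longrightarrow> \<zeta> s = \<rho> s * (1 - x s)"
  by (simp add: \<rho>_def)

text \<open>Eliminating \<open>\<zeta>\<close> leaves a Riccati equation: a quadratic whose roots
  are the eigenslopes, and a remainder with a factor \<open>1 - x\<close> that vanishes at the
  node.\<close>

lemma rho_deriv:
  assumes "x s \<noteq> 1"
  shows "(\<rho> has_real_derivative
     2 * (\<rho> s)\<^sup>2 - (d - p + \<kappa>) * \<rho> s + d - \<rho> s * ((p + 2) * \<rho> s - \<kappa>) * (1 - x s)) (at s)"
proof -
  have "(\<rho> has_real_derivative
     (((1 - \<zeta> s) * (p * \<zeta> s + d) - x s * (d + \<kappa> * \<zeta> s)) * (1 - x s) - \<zeta> s * (- (2 * x s * \<zeta> s)))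
       / ((1 - x s) * (1 - x s))) (at s)"
    unfolding \<rho>_def[abs_def] using assms
    by (auto intro!: derivative_eq_intros x_deriv zeta_deriv)
  moreover have "((1 - \<zeta> s) * (p * \<zeta> s + d) - x s * (d + \<kappa> * \<zeta> s)) * (1 - x s) - \<zeta> s * (- (2 * x s * \<zeta> s))
     = (2 * (\<rho> s)\<^sup>2 - (d - p + \<kappa>) * \<rho> s + d - \<rho> s * ((p + 2) * \<rho> s - \<kappa>) * (1 - x s)) * ((1 - x s) * (1 - x s))"
    unfolding zeta_eq_rho[OF assms] by (simp add: algebra_simps power2_eq_square)
  ultimately show ?thesis using assms by simp
qed

text \<open>The bound \<open>\<rho> < c < c2\<close> keeps the orbit off the fast direction. Then
  \<open>1 - x\<close> decays exponentially, the Riccati equation drives \<open>\<rho>\<close> to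
  \<open>c1\<close>, and integrating the logarithmic derivative \<open>- 2 * x * \<rho>\<close> of
  \<open>1 - x\<close> gives the exact rate. The sign \<open>\<sigma>\<close> treats both sides of
  \<open>x = 1\<close> at once.\<close>

lemma decay_of_slope_bound:
  fixes c c1 c2 \<sigma> s0 :: real
  assumes c1: "0 < c1" and c12: "c1 < c2" and prod: "d = 2 * c1 * c2" and sum: "d - p + \<kappa> = 2 * (c1 + c2)"
    and c: "0 < c" "c < c2" and \<sigma>: "\<sigma> = 1 \<or> \<sigma> = -1"
    and side: "\<And>s. s \<ge> s0 \<Longrightarrow> \<sigma> * (1 - x s) > 0"
    and rho: "\<And>s. s \<ge> s0 \<Longrightarrow> 0 < \<rho> s" "\<And>s. s \<ge> s0 \<Longrightarrow> \<rho> s < c"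
  shows "\<exists>B>0. ((\<lambda>s. (1 - x s) * exp (2 * c1 * s)) \<longlongrightarrow> \<sigma> * B) at_top"
proof -
  define e where "e s = \<sigma> * (1 - x s)" for s
  have \<sigma>2: "\<sigma> * \<sigma> = 1" and abs\<sigma>: "\<bar>\<sigma>\<bar> = 1" using \<sigma> by auto
  have eps: "1 - x s = \<sigma> * e s" for s using \<sigma> by (auto simp: e_def)
  have e_pos: "e s > 0" and xne: "x s \<noteq> 1" if "s \<ge> s0" for s
    using side[OF that] by (auto simp: e_def)
  have de: "(e has_real_derivative - 2 * x s * \<rho> s * e s) (at s)" if "s \<ge> s0" for s
    unfolding e_def[abs_def]
    by (auto intro!: derivative_eq_intros x_deriv simp: zeta_eq_rho[OF xne[OF that]])
  have e_mono: "e t \<le> e s" if "s0 \<le> s" "s \<le> t" for s t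
  proof (rule DERIV_nonpos_imp_nonincreasing[OF \<open>s \<le> t\<close>])
    fix r assume "s \<le> r" "r \<le> t"
    then have r: "s0 \<le> r" using that by simp
    have "0 < x r * \<rho> r * e r" using x_pos rho(1)[OF r] e_pos[OF r] by (intro mult_pos_pos) auto
    then have "- 2 * x r * \<rho> r * e r \<le> 0" by (simp add: mult.assoc)
    then show "\<exists>y. (e has_real_derivative y) (at r) \<and> y \<le> 0"
      using de[OF r] by blast
  qed
  \<comment> \<open>Since \<open>e\<close> decreases, \<open>x\<close> increases if
    \<open>\<sigma> = 1\<close> and stays above 1 if \<open>\<sigma> = -1\<close>; \<open>xm\<close>
    is a lower bound in both cases.\<close>
  define xm where "xm = min 1 (x s0)"
  have xm: "xm > 0" "x s \<ge> xm" if "s \<ge> s0" for s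
    using x_pos[of s0] e_mono[of s0 s] that e_pos[OF that] \<sigma> by (auto simp: xm_def e_def min_def)
  define P where "P = (p + 2) * c + \<kappa>"
  have Ppos: "P > 0" using c p_pos kappa_pos by (auto simp: P_def intro!: mult_pos_pos add_pos_pos)
  have P: "\<bar>(p + 2) * \<rho> s - \<kappa>\<bar> \<le> P" if "s \<ge> s0" for s
  proof -
    have "0 \<le> (p + 2) * \<rho> s" "(p + 2) * \<rho> s \<le> (p + 2) * c"
      using rho[OF that] p_pos by (auto intro!: mult_left_mono mult_nonneg_nonneg)
    then show ?thesis using kappa_pos unfolding P_def by linarith
  qed
  define Q where "Q = c * P"
  have Qpos: "Q > 0" using c Ppos by (auto simp: Q_def)
  have Q: "\<bar>\<rho> s * ((p + 2) * \<rho> s - \<kappa>) * \<sigma> * e s\<bar> \<le> Q * e s" if "s \<ge> s0" for s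
  proof -
    have "\<bar>\<rho> s\<bar> * \<bar>(p + 2) * \<rho> s - \<kappa>\<bar> \<le> Q"
      unfolding Q_def using rho[OF that] c P[OF that] by (intro mult_mono) auto
    then show ?thesis using e_pos[OF that] by (simp add: abs_mult abs\<sigma>)
  qed
  have Q': "\<bar>\<rho> s * ((p + 2) * \<rho> s - \<kappa>) * (1 - x s)\<bar> \<le> Q * e s" if "s \<ge> s0" for s
    using Q[OF that] by (simp add: eps mult.assoc)
  have rho': "(\<rho> has_real_derivative 2 * (\<rho> s - c1) * (\<rho> s - c2)
      - \<rho> s * ((p + 2) * \<rho> s - \<kappa>) * (1 - x s)) (at s)" if "s \<ge> s0" for s
    using rho_deriv[OF xne[OF that]] unfolding sum
    by (rule back_subst) (simp add: prod algebra_simps power2_eq_square)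
  \<comment> \<open>\<open>K\<close> is chosen to give \<open>\<rho>' \<ge> d - K * \<rho>\<close>;
    comparison with this linear equation keeps \<open>\<rho>\<close> above
    \<open>r0\<close>.\<close>
  define K where "K = 2 * (c1 + c2) + P * e s0"
  have K: "K > 0" using c1 c12 Ppos e_pos[of s0] by (auto simp: K_def intro!: add_pos_pos)
  define r0 where "r0 = min (\<rho> s0) (d / K)"
  have r0: "r0 > 0" using rho(1)[of s0] K d_pos by (auto simp: r0_def)
  have rho_ge: "\<rho> s \<ge> r0" if s: "s \<ge> s0" for s
  proof -
    have inc: "(\<rho> s0 - d / K) * exp (K * s0) \<le> (\<rho> s - d / K) * exp (K * s)"
    proof (rule DERIV_nonneg_imp_nondecreasing[OF s])
      fix r assume r: "s0 \<le> r" "r \<le> s"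
      let ?D = "2 * (\<rho> r - c1) * (\<rho> r - c2) - \<rho> r * ((p + 2) * \<rho> r - \<kappa>) * (1 - x r)"
      have "\<bar>((p + 2) * \<rho> r - \<kappa>) * (1 - x r)\<bar> \<le> P * e s0"
        using P[OF r(1)] e_mono[OF _ r(1)] e_pos[OF r(1)] Ppos
        by (auto simp: eps abs_mult abs\<sigma> intro!: mult_mono)
      then have "((p + 2) * \<rho> r - \<kappa>) * (1 - x r) \<le> P * e s0" by (simp add: abs_le_iff)
      then have "\<rho> r * (((p + 2) * \<rho> r - \<kappa>) * (1 - x r)) \<le> \<rho> r * (P * e s0)"
        using rho(1)[OF r(1)] by (intro mult_left_mono) auto
      moreover have "?D + K * \<rho> r - d
          = 2 * (\<rho> r * \<rho> r) + (\<rho> r * (P * e s0) - \<rho> r * (((p + 2) * \<rho> r - \<kappa>) * (1 - x r)))"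
        by (simp add: K_def prod algebra_simps)
      moreover have "\<rho> r * \<rho> r \<ge> 0" by simp
      ultimately have "?D + K * \<rho> r - d \<ge> 0" by linarith
      then have "(?D + K * \<rho> r - d) * exp (K * r) \<ge> 0" by (intro mult_nonneg_nonneg) auto
      then show "\<exists>y. ((\<lambda>s. (\<rho> s - d / K) * exp (K * s)) has_real_derivative y) (at r) \<and> 0 \<le> y"
        using K by (intro exI[of _ "(?D + K * \<rho> r - d) * exp (K * r)"] conjI)
          (auto intro!: derivative_eq_intros rho' r simp: algebra_simps)
    qed
    show ?thesis
    proof (cases "\<rho> s \<ge> d / K")
      case False
      then have "(\<rho> s - d / K) * exp (K * s) \<le> (\<rho> s - d / K) * exp (K * s0)"
        using s K by (intro mult_left_mono_neg) auto
      with inc have "\<rho> s0 - d / K \<le> \<rho> s - d / K"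
        using mult_le_cancel_right[of "\<rho> s0 - d / K" "exp (K * s0)" "\<rho> s - d / K"] by fastforce
      then show ?thesis by (simp add: r0_def)
    qed (simp add: r0_def)
  qed
  \<comment> \<open>The two lower bounds give \<open>e' \<le> - k * e\<close>. This rate is not
    sharp, but it makes the remaining perturbations integrable.\<close>
  define k where "k = 2 * xm * r0"
  have k: "k > 0" using xm[of s0] r0 by (simp add: k_def)
  define C where "C = e s0 * exp (k * s0)"
  have e_decay: "e s \<le> C * exp (- k * s)" if "s \<ge> s0" for s
  proof -
    have "e s * exp (k * s) \<le> e s0 * exp (k * s0)"
    proof (rule DERIV_nonpos_imp_nonincreasing[OF that])
      fix r assume r: "s0 \<le> r" "r \<le> s"
      have "xm * r0 \<le> x r * \<rho> r"
        using xm[OF r(1)] r0 rho_ge[OF r(1)] by (intro mult_mono) auto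
      then have "(k - 2 * x r * \<rho> r) * (e r * exp (k * r)) \<le> 0"
        using e_pos[OF r(1)] by (intro mult_nonpos_nonneg) (auto simp: k_def)
      then show "\<exists>y. ((\<lambda>s. e s * exp (k * s)) has_real_derivative y) (at r) \<and> y \<le> 0"
        by (intro exI[of _ "(k - 2 * x r * \<rho> r) * (e r * exp (k * r))"] conjI)
           (auto intro!: derivative_eq_intros de r simp: algebra_simps)
    qed
    then show ?thesis by (simp add: C_def exp_minus field_simps)
  qed
  have e_lim: "(e \<longlongrightarrow> 0) at_top"
  proof (rule tendsto_sandwich)
    show "eventually (\<lambda>s. 0 \<le> e s) at_top" "eventually (\<lambda>s. e s \<le> C * exp (- k * s)) at_top"
      using eventually_ge_at_top[of s0] by (eventually_elim; use e_pos e_decay in force)+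
    have "filterlim (\<lambda>s. - k * s) at_bot at_top"
      using k by (intro filterlim_tendsto_neg_mult_at_bot[OF tendsto_const]) (auto simp: filterlim_ident)
    then have "((\<lambda>s. C * exp (- k * s)) \<longlongrightarrow> C * 0) at_top"
      by (intro tendsto_intros filterlim_compose[OF exp_at_bot])
    then show "((\<lambda>s. C * exp (- k * s)) \<longlongrightarrow> 0) at_top" by simp
  qed simp
  \<comment> \<open>The Moebius coordinate that sends \<open>c1\<close> to 0 and \<open>c2\<close>
    to infinity turns the Riccati equation into \<open>y' = - M * y\<close> up to a term tending to
    0.\<close>
  define y where "y s = (\<rho> s - c1) / (c2 - \<rho> s)" for s
  define q where "q s = \<rho> s * ((p + 2) * \<rho> s - \<kappa>) * (1 - x s)" for s
  define M where "M = 2 * (c2 - c1)"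
  have M: "M > 0" using c12 by (simp add: M_def)
  have gap: "c2 - \<rho> s > c2 - c" if "s \<ge> s0" for s using rho[OF that] by simp
  have q_lim: "((\<lambda>s. - (c2 - c1) * (q s / (c2 - \<rho> s)\<^sup>2)) \<longlongrightarrow> 0) at_top"
  proof (rule Lim_null_comparison)
    show "eventually (\<lambda>s. norm (- (c2 - c1) * (q s / (c2 - \<rho> s)\<^sup>2)) \<le> (c2 - c1) * (Q * e s / (c2 - c)\<^sup>2)) at_top"
      using eventually_ge_at_top[of s0]
    proof eventually_elim
      case (elim s)
      have "\<bar>q s\<bar> / (c2 - \<rho> s)\<^sup>2 \<le> Q * e s / (c2 - c)\<^sup>2"
        using Q'[OF elim] gap[OF elim] c Qpos e_pos[OF elim]
        by (intro frac_le power_mono) (auto simp: q_def)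
      from mult_left_mono[OF this, of "c2 - c1"] show ?case using c12 by (simp add: abs_mult)
    qed
    have "((\<lambda>s. (c2 - c1) * (Q * e s / (c2 - c)\<^sup>2)) \<longlongrightarrow> (c2 - c1) * (Q * 0 / (c2 - c)\<^sup>2)) at_top"
      using c by (intro tendsto_intros e_lim) auto
    then show "((\<lambda>s. (c2 - c1) * (Q * e s / (c2 - c)\<^sup>2)) \<longlongrightarrow> 0) at_top" by simp
  qed
  have dy: "(y has_real_derivative - M * y s + - (c2 - c1) * (q s / (c2 - \<rho> s)\<^sup>2)) (at s)" if "s \<ge> s0" for s
  proof -
    have ne: "c2 - \<rho> s \<noteq> 0" using gap[OF that] c by auto
    have "(y has_real_derivative
       ((2 * (\<rho> s - c1) * (\<rho> s - c2) - q s) * (c2 - \<rho> s) - (\<rho> s - c1) * (- (2 * (\<rho> s - c1) * (\<rho> s - c2) - q s)))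
         / ((c2 - \<rho> s) * (c2 - \<rho> s))) (at s)"
      unfolding y_def[abs_def] q_def using ne
      by (auto intro!: derivative_eq_intros rho' that)
    moreover have "((2 * (\<rho> s - c1) * (\<rho> s - c2) - q s) * (c2 - \<rho> s) - (\<rho> s - c1) * (- (2 * (\<rho> s - c1) * (\<rho> s - c2) - q s)))
         / ((c2 - \<rho> s) * (c2 - \<rho> s)) = - M * y s + - (c2 - c1) * (q s / (c2 - \<rho> s)\<^sup>2)"
    proof -
      have "(2 * (\<rho> s - c1) * (\<rho> s - c2) - q s) * (c2 - \<rho> s) - (\<rho> s - c1) * (- (2 * (\<rho> s - c1) * (\<rho> s - c2) - q s))
        = - M * (\<rho> s - c1) * (c2 - \<rho> s) - (c2 - c1) * q s"
        unfolding M_def by (simp add: algebra_simps)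
      moreover have "(- M * a * g - k * r) / (g * g) = - M * (a / g) + - k * (r / g\<^sup>2)"
        if "g \<noteq> 0" for a g k r :: real
        using that by (simp add: field_simps power2_eq_square)
      ultimately show ?thesis unfolding y_def using ne by (simp only:)
    qed
    ultimately show ?thesis by simp
  qed
  have y_lim: "(y \<longlongrightarrow> 0) at_top"
  proof -
    let ?g = "\<lambda>s. - (c2 - c1) * (q s / (c2 - \<rho> s)\<^sup>2)"
    \<comment> \<open>L'Hospital's rule replaces variation of constants: the quotient of the
      derivatives is the forcing term divided by \<open>M\<close>.\<close>
    have "((\<lambda>s. y s * exp (M * s) / exp (M * s)) \<longlongrightarrow> 0) at_top"
    proof (rule lhospital_at_top_at_top)
      show "LIM s at_top. exp (M * s) :> at_top"
        using M by (intro filterlim_compose[OF exp_at_top] filterlim_tendsto_pos_mult_at_top[OF tendsto_const])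
           (auto simp: filterlim_ident)
      show "eventually (\<lambda>s. M * exp (M * s) \<noteq> 0) at_top" using M by simp
      show "eventually (\<lambda>s. ((\<lambda>s. exp (M * s)) has_real_derivative M * exp (M * s)) (at s)) at_top"
        by (intro always_eventually allI) (auto intro!: derivative_eq_intros)
      show "eventually (\<lambda>s. ((\<lambda>s. y s * exp (M * s)) has_real_derivative ?g s * exp (M * s)) (at s)) at_top"
        using eventually_ge_at_top[of s0]
        by eventually_elim (auto intro!: derivative_eq_intros dy simp: algebra_simps)
      have "((\<lambda>s. ?g s / M) \<longlongrightarrow> 0 / M) at_top" using M by (intro tendsto_divide q_lim) auto
      then show "((\<lambda>s. ?g s * exp (M * s) / (M * exp (M * s))) \<longlongrightarrow> 0) at_top" by simp
    qed
    then show ?thesis by simp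
  qed
  have rho_lim: "((\<lambda>s. c2 - \<rho> s) \<longlongrightarrow> c2 - c1) at_top"
  proof -
    have "((\<lambda>s. (c2 - c1) / (1 + y s)) \<longlongrightarrow> (c2 - c1) / (1 + 0)) at_top"
      by (intro tendsto_intros y_lim) auto
    moreover have "eventually (\<lambda>s. (c2 - c1) / (1 + y s) = c2 - \<rho> s) at_top"
      using eventually_ge_at_top[of s0]
    proof eventually_elim
      case (elim s)
      have "c2 - \<rho> s \<noteq> 0" using gap[OF elim] c by auto
      then have "1 + y s = (c2 - c1) / (c2 - \<rho> s)" by (simp add: y_def field_simps)
      then show ?case using c12 by simp
    qed
    ultimately show ?thesis by (simp add: Lim_transform_eventually)
  qed
  \<comment> \<open>The term \<open>ln (c2 - \<rho>)\<close> cancels the contribution of \<open>\<rho> - c1\<close> to the derivative of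
    \<open>ln e + 2 * c1 * s\<close>, so that no decay rate for \<open>\<rho> - c1\<close> is needed.\<close>
  define E where "E s = ln (e s) + 2 * c1 * s + ln (c2 - \<rho> s)" for s
  have dE: "(E has_real_derivative 2 * \<rho> s * (1 - x s) + q s / (c2 - \<rho> s)) (at s)" if "s \<ge> s0" for s
  proof -
    have g: "c2 - \<rho> s > 0" using gap[OF that] c by auto
    have "(E has_real_derivative - 2 * x s * \<rho> s * e s / e s + 2 * c1
        + - (2 * (\<rho> s - c1) * (\<rho> s - c2) - q s) / (c2 - \<rho> s)) (at s)"
      unfolding E_def[abs_def] q_def using g e_pos[OF that]
      by (auto intro!: derivative_eq_intros de rho' that)
    moreover have "- 2 * x s * \<rho> s * e s / e s + 2 * c1
        + - (2 * (\<rho> s - c1) * (\<rho> s - c2) - q s) / (c2 - \<rho> s) = 2 * \<rho> s * (1 - x s) + q s / (c2 - \<rho> s)"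
      using g e_pos[OF that] by (simp add: field_simps)
    ultimately show ?thesis by simp
  qed
  \<comment> \<open>The derivative of \<open>E\<close> is bounded by a multiple of \<open>e\<close>.
    Working with the logarithm makes the final limit \<open>exp l / (c2 - c1)\<close> strictly
    positive.\<close>
  obtain l where l: "(E \<longlongrightarrow> l) at_top"
  proof (rule convergent_at_top_of_deriv_exp_bound[OF dE _ k])
    fix s assume s: "s0 \<le> s"
    have "\<bar>2 * \<rho> s * (1 - x s)\<bar> = 2 * \<rho> s * e s"
      using rho(1)[OF s] e_pos[OF s] by (simp add: eps abs_mult abs\<sigma>)
    also have "\<dots> \<le> 2 * c * e s" using rho[OF s] e_pos[OF s] by simp
    finally have 1: "\<bar>2 * \<rho> s * (1 - x s)\<bar> \<le> 2 * c * e s" .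
    have "\<bar>q s\<bar> / (c2 - \<rho> s) \<le> Q * e s / (c2 - c)"
      using Q'[OF s] gap[OF s] c Qpos e_pos[OF s] by (intro frac_le) (auto simp: q_def)
    then have "\<bar>q s / (c2 - \<rho> s)\<bar> \<le> Q * e s / (c2 - c)" using gap[OF s] c by simp
    with 1 have "\<bar>2 * \<rho> s * (1 - x s) + q s / (c2 - \<rho> s)\<bar> \<le> (2 * c + Q / (c2 - c)) * e s"
      using abs_triangle_ineq[of "2 * \<rho> s * (1 - x s)" "q s / (c2 - \<rho> s)"]
      by (simp add: distrib_right)
    also have "\<dots> \<le> (2 * c + Q / (c2 - c)) * (C * exp (- k * s))"
      using c Qpos by (intro mult_left_mono e_decay s) auto
    finally show "\<bar>2 * \<rho> s * (1 - x s) + q s / (c2 - \<rho> s)\<bar> \<le> ((2 * c + Q / (c2 - c)) * C) * exp (- k * s)"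
      by (simp add: mult.assoc)
  qed
  have "((\<lambda>s. \<sigma> * (exp (E s) / (c2 - \<rho> s))) \<longlongrightarrow> \<sigma> * (exp l / (c2 - c1))) at_top"
    using c12 by (intro tendsto_intros l rho_lim) auto
  moreover have "eventually (\<lambda>s. \<sigma> * (exp (E s) / (c2 - \<rho> s)) = (1 - x s) * exp (2 * c1 * s)) at_top"
    using eventually_ge_at_top[of s0]
  proof eventually_elim
    case (elim s)
    have "c2 - \<rho> s > 0" using gap[OF elim] c by auto
    then show ?case using e_pos[OF elim] by (simp add: E_def exp_add eps)
  qed
  ultimately have "((\<lambda>s. (1 - x s) * exp (2 * c1 * s)) \<longlongrightarrow> \<sigma> * (exp l / (c2 - c1))) at_top"
    by (rule Lim_transform_eventually)
  then show ?thesis using c12 by (intro exI[of _ "exp l / (c2 - c1)"]) auto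
qed

end

section \<open>Passage from the saddle to the node\<close>

text \<open>\<open>2 * c1\<close> and \<open>2 * c2\<close> are the exponents \<open>\<gamma>\<^sub>1\<close> and \<open>\<gamma>\<^sub>2\<close>: the slopes of the
  eigendirections at \<open>(1, 0)\<close> are \<open>\<zeta> / (1 - x) = c1, c2\<close>.\<close>

locale node_profile = profile_system +
  fixes c1 c2 :: real
  assumes c1_pos: "0 < c1" and c1_less_c2: "c1 < c2"
    and c_prod: "d = 2 * c1 * c2" and c_sum: "d - p + \<kappa> = 2 * (c1 + c2)"
begin

lemmas decay = decay_of_slope_bound[OF c1_pos c1_less_c2 c_prod c_sum]

text \<open>The quadratic with roots \<open>c1\<close>, \<open>c2\<close> is evaluated at 1, the
  slope of the segment. Its sign and \<open>c1 * c2 = d / 2\<close> place the roots relative to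
  1.\<close>

lemma roots_at_1: "2 * ((1 - c1) * (1 - c2)) = p + 2 - \<kappa>"
  using c_prod c_sum by (simp add: algebra_simps)

text \<open>For \<open>c\<close> strictly between the roots the first term in the bracket is
  negative. Where the second does not oppose it, the line can be crossed in one direction
  only.\<close>

lemma barrier_deriv:
  assumes "\<zeta> s = c * (1 - x s)"
  shows "((\<lambda>s. \<zeta> s - c * (1 - x s)) has_real_derivative
    (1 - x s) * (2 * ((c - c1) * (c - c2)) - c * ((p + 2) * c - \<kappa>) * (1 - x s))) (at s)"
proof -
  have "((\<lambda>s. \<zeta> s - c * (1 - x s)) has_real_derivative
    ((1 - \<zeta> s) * (p * \<zeta> s + d) - x s * (d + \<kappa> * \<zeta> s)) + c * (2 * x s * \<zeta> s)) (at s)"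
    by (auto intro!: derivative_eq_intros x_deriv zeta_deriv)
  moreover have eq: "2 * ((c - c1) * (c - c2)) = 2 * (c * c) - (d - p + \<kappa>) * c + d"
    unfolding c_sum by (simp add: c_prod algebra_simps)
  have "((1 - \<zeta> s) * (p * \<zeta> s + d) - x s * (d + \<kappa> * \<zeta> s)) + c * (2 * x s * \<zeta> s)
    = (1 - x s) * (2 * ((c - c1) * (c - c2)) - c * ((p + 2) * c - \<kappa>) * (1 - x s))"
    unfolding assms eq by (simp add: algebra_simps)
  ultimately show ?thesis by (simp only:)
qed

text \<open>\<open>1 / x - 1\<close> has the sign of \<open>1 - x\<close>. With the weight it
  increases below the line \<open>\<zeta> = c * (1 - x)\<close> and decreases above it, so the
  barrier also controls on which side of \<open>x = 1\<close> the orbit stays.\<close>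

lemma ratio_deriv:
  "((\<lambda>s. (1 / x s - 1) * exp (2 * c * s)) has_real_derivative
     2 * (c * (1 - x s) - \<zeta> s) / x s * exp (2 * c * s)) (at s)"
  using x_pos[of s] by (auto intro!: derivative_eq_intros x_deriv simp: field_simps)

lemma x_mono:
  assumes "s \<le> t" "\<And>r. s \<le> r \<Longrightarrow> \<zeta> r \<ge> 0"
  shows "x s \<le> x t"
proof (rule DERIV_nonneg_imp_nondecreasing[OF assms(1)])
  fix r assume "s \<le> r"
  then have "2 * x r * \<zeta> r \<ge> 0" using assms(2)[of r] x_pos[of r] by simp
  then show "\<exists>y. (x has_real_derivative y) (at r) \<and> 0 \<le> y" using x_deriv by blast
qed

lemma eventually_x_less_1: "eventually (\<lambda>s. x s < 1) at_bot"
  using x_tendsto_at_bot by (rule order_tendstoD) simp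

lemma eventually_zeta_pos: "eventually (\<lambda>s. \<zeta> s > 0) at_bot"
  using zeta_tendsto_at_bot by (rule order_tendstoD) simp

lemma zeta_deriv_at_zero:
  assumes "\<zeta> s = 0"
  shows "(\<zeta> has_real_derivative d * (1 - x s)) (at s)"
  using zeta_deriv[of s] assms by (simp add: algebra_simps)

text \<open>At a first zero of \<open>\<zeta>\<close> the orbit is not below the segment, so
  \<open>x \<ge> 1\<close>, strictly if \<open>\<kappa> < p + 2\<close>. The second alternative
  admits the time at which \<open>x\<close> equals 1.\<close>

lemma zeta_pos_while_x_le_1:
  assumes "\<kappa> \<le> p + 2" "\<And>t. t \<le> s \<Longrightarrow> x t < 1 \<or> (x t \<le> 1 \<and> \<kappa> < p + 2)"
  shows "\<zeta> s > 0"
proof (rule ccontr)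
  assume "\<not> \<zeta> s > 0"
  then have *: "\<zeta> s \<le> 0" by simp
 obtain t where t: "t \<le> s" "\<zeta> t = 0" "\<And>r. r < t \<Longrightarrow> \<zeta> r > 0"
    by (rule first_zero_at_bot[OF zeta_cont eventually_zeta_pos *]) blast
  have "\<zeta> t \<ge> 1 - x t" using line_above_weak[OF assms(1), of t] t(3) by blast
  then have "\<zeta> t > 1 - x t" using line_above[of t] t(3) assms(2)[OF t(1)] t(2) by force
  then show False using t(2) \<open>\<zeta> t \<ge> 1 - x t\<close> assms(2)[OF t(1)] by auto
qed

text \<open>The triangle \<open>0 < \<zeta> < 1 - x\<close> is a trap: the segment is not reached
  while \<open>\<zeta> > 0\<close>, and at a first zero \<open>\<zeta>' = d * (1 - x) > 0\<close>.
  Hence \<open>0 < \<rho> < 1\<close>, and \<open>1 < c2\<close> lets \<open>c = 1\<close> serve as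
  the slope bound.\<close>

lemma decay_from_below_if_large:
  assumes "\<kappa> > p + 2"
  shows "\<exists>B>0. ((\<lambda>s. (1 - x s) * exp (2 * c1 * s)) \<longlongrightarrow> B) at_top"
proof -
  have pos: "\<zeta> s > 0" for s
  proof (rule ccontr)
    assume "\<not> \<zeta> s > 0"
  then have *: "\<zeta> s \<le> 0" by simp
   obtain t where t: "t \<le> s" "\<zeta> t = 0" "\<And>r. r < t \<Longrightarrow> \<zeta> r > 0"
      by (rule first_zero_at_bot[OF zeta_cont eventually_zeta_pos *]) blast
    have "1 - x t > 0" using line_below[OF assms, of t] t by auto
    moreover have "d * (1 - x t) \<le> 0"
      by (rule deriv_nonpos_at_first_zero[OF zeta_deriv_at_zero[OF t(2)] t(2), of "t - 1"]) (use t in auto)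
    ultimately show False using d_pos by (simp add: mult_le_0_iff)
  qed
  have below: "\<zeta> s < 1 - x s" for s using line_below[OF assms] pos by blast
  have "(1 - c1) * (1 - c2) < 0" using roots_at_1 assms by linarith
  then have "1 < c2" using c1_less_c2 by (auto simp: mult_less_0_iff)
  moreover have "1 - x s > 0" for s using pos[of s] below[of s] by linarith
  ultimately show ?thesis
    using decay[of 1 1 0] pos below by (auto simp: \<rho>_def divide_less_eq)
qed

text \<open>Here \<open>1 \<le> c1 < c2\<close>, so a line through the node with slope between the
  roots passes above the saddle. The orbit starts below this line and can neither cross it nor reach
  \<open>x = 1\<close> beneath it.\<close>

lemma decay_from_below_if_d_large:
  assumes "\<kappa> \<le> p + 2" "d > 2"
  shows "\<exists>B>0. ((\<lambda>s. (1 - x s) * exp (2 * c1 * s)) \<longlongrightarrow> B) at_top"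
proof -
  have c2: "c2 > 1"
  proof (rule ccontr)
    assume "\<not> c2 > 1"
    then have "c1 * c2 \<le> 1 * 1" using c1_pos c1_less_c2 by (intro mult_mono) auto
    then show False using assms(2) c_prod by simp
  qed
  have "(1 - c1) * (1 - c2) \<ge> 0" using roots_at_1 assms by linarith
  then have c1: "c1 \<ge> 1" using c2 by (simp add: zero_le_mult_iff)
  define c where "c = (c1 + c2) / 2"
  have c: "c1 < c" "c < c2" "c > 1" using c1 c1_less_c2 by (auto simp: c_def)
  have G: "(c - c1) * (c - c2) < 0" using c by (auto simp: mult_less_0_iff)
  \<comment> \<open>By \<open>c > 1\<close> and \<open>\<kappa> \<le> p + 2\<close> the second term
    of the barrier derivative reinforces the first where \<open>x < 1\<close>.\<close>
  have kc: "c * ((p + 2) * c - \<kappa>) > 0"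
  proof -
    have "(p + 2) * 1 < (p + 2) * c" using c p_pos by (intro mult_strict_left_mono) auto
    then show ?thesis using c assms(1) by (intro mult_pos_pos) auto
  qed
  have x_less: "x t < 1" if below: "\<And>r. r < t \<Longrightarrow> \<zeta> r < c * (1 - x r)" for t
  proof -
    obtain a where a: "a < t" "x a < 1"
    proof -
      obtain a where "\<And>s. s \<le> a \<Longrightarrow> x s < 1"
        using eventually_x_less_1 by (auto simp: eventually_at_bot_linorder)
      then show ?thesis using that[of "min a (t - 1)"] by auto
    qed
    let ?h = "\<lambda>s. (1 / x s - 1) * exp (2 * c * s)"
    have "?h a < ?h t"
    proof (rule DERIV_pos_imp_increasing_open[OF a(1)])
      fix r assume "a < r" "r < t"
      then have "2 * (c * (1 - x r) - \<zeta> r) / x r * exp (2 * c * r) > 0"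
        using below[of r] x_pos[of r] by (intro mult_pos_pos divide_pos_pos) auto
      then show "\<exists>y. (?h has_real_derivative y) (at r) \<and> y > 0" using ratio_deriv by blast
    next
      show "continuous_on {a..t} ?h"
        using DERIV_isCont[OF ratio_deriv] by (intro continuous_at_imp_continuous_on) auto
    qed
    moreover have "?h a > 0" using a x_pos[of a] by (intro mult_pos_pos) auto
    ultimately have "?h t > 0" by linarith
    then show ?thesis using x_pos[of t] by (simp add: zero_less_mult_iff)
  qed
  have below: "\<zeta> s < c * (1 - x s)" for s
  proof (rule ccontr)
    assume "\<not> \<zeta> s < c * (1 - x s)"
    then have *: "- (\<zeta> s - c * (1 - x s)) \<le> 0" by simp
    have "((\<lambda>s. - (\<zeta> s - c * (1 - x s))) \<longlongrightarrow> - (1 - c * (1 - 0))) at_bot"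
      by (intro tendsto_intros zeta_tendsto_at_bot x_tendsto_at_bot)
    then have "eventually (\<lambda>s. - (\<zeta> s - c * (1 - x s)) > 0) at_bot"
      by (rule order_tendstoD) (use c in simp)
    moreover have "continuous_on UNIV (\<lambda>s. - (\<zeta> s - c * (1 - x s)))"
      by (intro continuous_intros zeta_cont x_cont)
    ultimately obtain t where t: "- (\<zeta> t - c * (1 - x t)) = 0" "\<And>r. r < t \<Longrightarrow> - (\<zeta> r - c * (1 - x r)) > 0"
      using * first_zero_at_bot[where g = "\<lambda>s. - (\<zeta> s - c * (1 - x s))" and b = s] by blast
    then have eq: "\<zeta> t = c * (1 - x t)" and lt: "\<And>r. r < t \<Longrightarrow> \<zeta> r < c * (1 - x r)" by force+
    have x1: "1 - x t > 0" using x_less[OF lt] by simp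
    let ?D = "2 * ((c - c1) * (c - c2)) - c * ((p + 2) * c - \<kappa>) * (1 - x t)"
    have "- ((1 - x t) * ?D) \<le> 0"
      by (rule deriv_nonpos_at_first_zero[OF DERIV_minus[OF barrier_deriv[OF eq]] t(1), of "t - 1"])
         (use t(2) in auto)
    moreover have "?D < 0" using G mult_pos_pos[OF kc x1] by linarith
    then have "(1 - x t) * ?D < 0" using x1 by (simp add: mult_pos_neg)
    ultimately show False by linarith
  qed
  have x1: "1 - x s > 0" for s using x_less[of s] below by auto
  have pos: "\<zeta> s > 0" for s using zeta_pos_while_x_le_1[OF assms(1), of s] x1 by force
  show ?thesis
    using decay[of c 1 0] pos below x1 c by (auto simp: \<rho>_def divide_less_eq)
qed

text \<open>Both roots are below 1 and the orbit starts above the segment, so it overshoots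
  \<open>x = 1\<close> with \<open>\<zeta> > 0\<close>. Beyond, it stays above a barrier line, has
  to turn down through \<open>\<zeta> = 0\<close>, and ends in the sector where
  \<open>\<zeta>\<close> and \<open>1 - x\<close> are both negative.\<close>

lemma decay_from_above:
  assumes kp: "\<kappa> < p + 2" and d2: "d < 2"
  shows "\<exists>B>0. ((\<lambda>s. (1 - x s) * exp (2 * c1 * s)) \<longlongrightarrow> - B) at_top"
proof -
  have prod1: "(1 - c1) * (1 - c2) > 0" using roots_at_1 kp by linarith
  have c1: "c1 < 1"
  proof (rule ccontr)
    assume "\<not> c1 < 1"
    then have "1 * 1 \<le> c1 * c2" using c1_less_c2 by (intro mult_mono) auto
    then show False using d2 c_prod by simp
  qed
  then have c2: "c2 < 1" using prod1 by (simp add: zero_less_mult_iff)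
  \<comment> \<open>This gives the second term of the barrier derivative the right sign where
    \<open>x > 1\<close>. The quotient \<open>t = \<kappa> / (p + 2)\<close> exceeds both roots: the
    quadratic is positive at \<open>t\<close>, and the relation for the sum puts \<open>t\<close>
    above \<open>c1\<close>.\<close>
  have c2k: "(p + 2) * c2 < \<kappa>"
  proof -
    define t where "t = \<kappa> / (p + 2)"
    have k: "\<kappa> = (p + 2) * t" using p_pos by (simp add: t_def)
    have t: "0 < t" "t < 1" using p_pos kappa_pos kp by (auto simp: t_def)
    have "(p + 2) * t + 2 * c1 * c2 - p = 2 * (c1 + c2)" using c_sum k c_prod by simp
    then have id: "p * (1 - t) + 2 * (c1 - t) + 2 * c2 * (1 - c1) = 0" by (simp add: algebra_simps)
    have "c1 < t"
    proof (rule ccontr)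
      assume "\<not> c1 < t"
      moreover have "p * (1 - t) > 0" "2 * c2 * (1 - c1) > 0"
        using t p_pos c1 c1_pos c1_less_c2 by auto
      ultimately have "p * (1 - t) + 2 * (c1 - t) + 2 * c2 * (1 - c1) > 0"
        by (intro add_pos_pos add_pos_nonneg) auto
      then show False using id by simp
    qed
    have "2 * ((t - c1) * (t - c2)) = (1 - t) * (p * t + d)"
    proof -
      have "2 * ((t - c1) * (t - c2)) = 2 * (t * t) - (d - p + \<kappa>) * t + d"
        unfolding c_sum by (simp add: c_prod algebra_simps)
      then show ?thesis unfolding k by (simp add: algebra_simps)
    qed
    moreover have "(1 - t) * (p * t + d) > 0" using t p_pos d_pos by (intro mult_pos_pos add_pos_pos) auto
    ultimately have "(t - c1) * (t - c2) > 0" by linarith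
    with \<open>c1 < t\<close> have "c2 < t" by (simp add: zero_less_mult_iff)
    then show ?thesis using p_pos by (simp add: k)
  qed
  define c where "c = (c1 + c2) / 2"
  have c: "c1 < c" "c < c2" "c > 0" using c1_pos c1_less_c2 by (auto simp: c_def)
  have G: "(c - c1) * (c - c2) < 0" using c by (auto simp: mult_less_0_iff)
  have kc: "c * ((p + 2) * c - \<kappa>) \<le> 0"
  proof -
    have "(p + 2) * c \<le> (p + 2) * c2" using c p_pos by (intro mult_left_mono) auto
    then show ?thesis using c c2k by (intro mult_nonneg_nonpos) auto
  qed
  \<comment> \<open>Otherwise \<open>\<rho> > 1 > c2\<close> forever, and \<open>\<rho>\<close> blows up in finite time.\<close>
  have "\<exists>s. x s \<ge> 1"
  proof (rule ccontr)
    assume "\<not> (\<exists>s. x s \<ge> 1)"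
    then have x1: "x s < 1" for s by (simp add: not_le)
    have pos: "\<zeta> s > 0" for s using zeta_pos_while_x_le_1[of s] kp x1 by force
    have above: "\<zeta> s > 1 - x s" for s using line_above[OF kp] pos by blast
    have xmono: "x s \<le> x t" if "s \<le> t" for s t
      using x_mono[OF that] pos by (simp add: less_imp_le)
    \<comment> \<open>\<open>\<delta>\<close> bounds the quadratic growth of \<open>\<rho>\<close>
      from below; \<open>\<eta>\<close> is chosen so that for \<open>1 - x \<le> \<eta>\<close> the
      remainder takes away at most half of it.\<close>
    define \<delta> where "\<delta> = p + 2 - \<kappa>"
    define \<eta> where "\<eta> = \<delta> / 2 / (p + 2)"
    have \<delta>: "\<delta> > 0" using kp by (auto simp: \<delta>_def)
    then have \<eta>: "\<eta> > 0" "(p + 2) * \<eta> = \<delta> / 2" using p_pos by (simp_all add: \<eta>_def field_simps)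
    \<comment> \<open>Since \<open>\<zeta> > 1 - x\<close>, staying at distance
      \<open>\<eta>\<close> from 1 would make \<open>x\<close> grow at least linearly.\<close>
    have "\<exists>a\<ge>0. 1 - x a < \<eta>"
    proof (rule ccontr)
      assume "\<not> (\<exists>a\<ge>0. 1 - x a < \<eta>)"
      then have "\<zeta> s \<ge> \<eta>" if "s \<ge> 0" for s using that above[of s] by force
      then have "2 * x s * \<zeta> s \<ge> 2 * x 0 * \<eta>" if "s \<ge> 0" for s
        using that \<eta> xmono[of 0 s] less_imp_le[OF x_pos] by (intro mult_mono) auto
      then have "\<exists>s\<ge>0. x s > 1"
        by (rule unbounded_of_deriv_ge[OF x_deriv]) (use x_pos \<eta> in auto)
      then show False using x1 by (meson less_asym)
    qed
    then obtain a where a: "1 - x a < \<eta>" by blast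
    have rho1: "\<rho> s > 1" for s using above[of s] x1[of s] by (simp add: \<rho>_def)
    \<comment> \<open>The reciprocal turns blow-up into linear growth: the derivative of
      \<open>- (1 / \<rho>)\<close> is at least \<open>\<delta> / 2\<close>, which would push it
      past 0.\<close>
    have "\<exists>s\<ge>a. - (1 / \<rho> s) > 0"
    proof (rule unbounded_of_deriv_ge)
      fix s assume s: "s \<ge> a"
      define R where "R = 2 * (\<rho> s)\<^sup>2 - (d - p + \<kappa>) * \<rho> s + d - \<rho> s * ((p + 2) * \<rho> s - \<kappa>) * (1 - x s)"
      have "x s \<noteq> 1" using x1[of s] by simp
      from rho_deriv[OF this] show "((\<lambda>s. - (1 / \<rho> s)) has_real_derivative R / (\<rho> s)\<^sup>2) (at s)"
        using rho1[of s] unfolding R_def[symmetric]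
        by (auto intro!: derivative_eq_intros simp: power2_eq_square)
      have e: "0 \<le> 1 - x s" "1 - x s \<le> \<eta>" using a xmono[OF s] x1[of s] by auto
      have "(\<rho> s - c1) * (\<rho> s - c2) \<ge> (\<rho> s * (1 - c1)) * (\<rho> s * (1 - c2))"
      proof (intro mult_mono)
        show "\<rho> s * (1 - c1) \<le> \<rho> s - c1" "\<rho> s * (1 - c2) \<le> \<rho> s - c2"
          using rho1[of s] c1_pos c1_less_c2 by (auto simp: algebra_simps)
      qed (use rho1[of s] c1 c2 in auto)
      moreover have "2 * ((\<rho> s * (1 - c1)) * (\<rho> s * (1 - c2))) = \<delta> * (\<rho> s)\<^sup>2"
        unfolding \<delta>_def roots_at_1[symmetric] by (simp add: power2_eq_square)
      ultimately have 1: "2 * ((\<rho> s - c1) * (\<rho> s - c2)) \<ge> \<delta> * (\<rho> s)\<^sup>2" by linarith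
      have "(p + 2) * (1 - x s) \<le> \<delta> / 2"
        using mult_left_mono[OF e(2), of "p + 2"] \<eta>(2) p_pos by simp
      then have "(p + 2) * (1 - x s) * (\<rho> s)\<^sup>2 \<le> \<delta> / 2 * (\<rho> s)\<^sup>2" by (intro mult_right_mono) auto
      moreover have "\<kappa> * \<rho> s * (1 - x s) \<ge> 0" using kappa_pos rho1[of s] e by (intro mult_nonneg_nonneg) auto
      moreover have "R = 2 * ((\<rho> s - c1) * (\<rho> s - c2)) - (p + 2) * (1 - x s) * (\<rho> s)\<^sup>2 + \<kappa> * \<rho> s * (1 - x s)"
        unfolding R_def c_sum by (simp add: c_prod algebra_simps power2_eq_square)
      ultimately have "R \<ge> \<delta> / 2 * (\<rho> s)\<^sup>2" using 1 by (simp add: field_simps)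
      then show "R / (\<rho> s)\<^sup>2 \<ge> \<delta> / 2" using rho1[of s] by (simp add: pos_le_divide_eq)
    qed (use \<delta> in auto)
    then obtain s where "- (1 / \<rho> s) > 0" by blast
    then show False using rho1[of s] by simp
  qed
  then obtain b where b: "1 - x b \<le> 0" by force
  have "continuous_on UNIV (\<lambda>s. 1 - x s)" by (intro continuous_intros x_cont)
  moreover have "eventually (\<lambda>s. 1 - x s > 0) at_bot" using eventually_x_less_1 by simp
  ultimately obtain s1 where s1: "1 - x s1 = 0" "\<And>r. r < s1 \<Longrightarrow> 1 - x r > 0"
    using b first_zero_at_bot[where g = "\<lambda>s. 1 - x s" and b = b] by blast
  have z1: "\<zeta> s1 > 0"
  proof (rule zeta_pos_while_x_le_1)
    show "x t < 1 \<or> (x t \<le> 1 \<and> \<kappa> < p + 2)" if "t \<le> s1" for t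
      using s1 kp that by (cases "t = s1") force+
  qed (use kp in simp)
  \<comment> \<open>The mirror image of the argument for \<open>x < 1\<close>: \<open>?h\<close>
    vanishes at \<open>s1\<close> and increases while the orbit is above the line.\<close>
  have x_gr: "x t > 1" if t: "t > s1" and ab: "\<And>r. s1 \<le> r \<Longrightarrow> r < t \<Longrightarrow> \<zeta> r > c * (1 - x r)" for t
  proof -
    let ?h = "\<lambda>s. - ((1 / x s - 1) * exp (2 * c * s))"
    have "?h s1 < ?h t"
    proof (rule DERIV_pos_imp_increasing_open[OF t])
      fix r assume "s1 < r" "r < t"
      then have "2 * (\<zeta> r - c * (1 - x r)) / x r * exp (2 * c * r) > 0"
        using ab[of r] x_pos[of r] by (intro mult_pos_pos divide_pos_pos) auto
      then have "- (2 * (c * (1 - x r) - \<zeta> r) / x r * exp (2 * c * r)) > 0"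
        by (simp add: algebra_simps diff_divide_distrib)
      then show "\<exists>y. (?h has_real_derivative y) (at r) \<and> y > 0" using DERIV_minus[OF ratio_deriv] by blast
    next
      show "continuous_on {s1..t} ?h"
        using DERIV_isCont[OF DERIV_minus[OF ratio_deriv]] by (intro continuous_at_imp_continuous_on) auto
    qed
    then have "?h t > 0" using s1 by simp
    then show ?thesis using x_pos[of t] by (simp add: mult_less_0_iff)
  qed
  have above: "\<zeta> s > c * (1 - x s)" if s: "s \<ge> s1" for s
  proof (rule ccontr)
    assume "\<not> \<zeta> s > c * (1 - x s)"
    then have *: "\<zeta> s - c * (1 - x s) \<le> 0" by simp
    have "continuous_on {s1..s} (\<lambda>s. \<zeta> s - c * (1 - x s))"
      by (intro continuous_intros zeta_cont x_cont)
    moreover have "\<zeta> s1 - c * (1 - x s1) > 0" using z1 s1(1) by simp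
    ultimately obtain t where t: "s1 < t" "\<zeta> t - c * (1 - x t) = 0"
       "\<And>r. s1 \<le> r \<Longrightarrow> r < t \<Longrightarrow> \<zeta> r - c * (1 - x r) > 0"
      using s * first_zero[where g = "\<lambda>s. \<zeta> s - c * (1 - x s)" and a = s1 and b = s] by blast
    then have eq: "\<zeta> t = c * (1 - x t)" and gt: "\<And>r. s1 \<le> r \<Longrightarrow> r < t \<Longrightarrow> \<zeta> r > c * (1 - x r)" by force+
    have x1: "1 - x t < 0" using x_gr[OF t(1) gt] by simp
    let ?D = "2 * ((c - c1) * (c - c2)) - c * ((p + 2) * c - \<kappa>) * (1 - x t)"
    have "(1 - x t) * ?D \<le> 0"
      by (rule deriv_nonpos_at_first_zero[OF barrier_deriv[OF eq] t(2,1)]) (use t(3) in auto)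
    moreover have "c * ((p + 2) * c - \<kappa>) * (1 - x t) \<ge> 0" using kc x1 by (intro mult_nonpos_nonpos) auto
    then have "?D < 0" using G by linarith
    then have "(1 - x t) * ?D > 0" using x1 by (simp add: mult_neg_neg)
    ultimately show False by linarith
  qed
  have x1: "x s > 1" if "s > s1" for s using x_gr[OF that] above by blast
  \<comment> \<open>One unit past \<open>s1\<close>, \<open>x a > 1\<close> holds strictly, so
    \<open>d * (x a - 1)\<close> is a positive lower bound for \<open>- \<zeta>'\<close> as long as
    \<open>\<zeta> \<ge> 0\<close>.\<close>
  define a where "a = s1 + 1"
  have "\<exists>s\<ge>a. \<zeta> s < 0"
  proof (rule ccontr)
    assume "\<not> (\<exists>s\<ge>a. \<zeta> s < 0)"
    then have nn: "\<zeta> s \<ge> 0" if "s \<ge> a" for s using that by force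
    have xmono: "x a \<le> x t" if "a \<le> t" for t
      using x_mono[OF that] nn by simp
    have "\<exists>s\<ge>a. - \<zeta> s > 0"
    proof (rule unbounded_of_deriv_ge[OF DERIV_minus[OF zeta_deriv]])
      fix s assume s: "a \<le> s"
      have "- ((1 - \<zeta> s) * (p * \<zeta> s + d) - x s * (d + \<kappa> * \<zeta> s))
         = 2 * (c1 + c2) * \<zeta> s + p * (\<zeta> s * \<zeta> s) + d * (x s - 1) + \<kappa> * ((x s - 1) * \<zeta> s)"
        unfolding c_sum[symmetric] by (simp add: algebra_simps)
      moreover have "d * (x s - 1) \<ge> d * (x a - 1)" using xmono[OF s] d_pos by (intro mult_left_mono) auto
      moreover have "2 * (c1 + c2) * \<zeta> s \<ge> 0" "p * (\<zeta> s * \<zeta> s) \<ge> 0" "\<kappa> * ((x s - 1) * \<zeta> s) \<ge> 0"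
        using c1_pos c1_less_c2 p_pos kappa_pos nn[OF s] x1[of s] s by (auto simp: a_def)
      ultimately show "d * (x a - 1) \<le> - ((1 - \<zeta> s) * (p * \<zeta> s + d) - x s * (d + \<kappa> * \<zeta> s))" by linarith
    qed (use d_pos x1[of a] in \<open>auto simp: a_def\<close>)
    then show False using nn by force
  qed
  then obtain s2 where s2: "s2 \<ge> a" "\<zeta> s2 < 0" by blast
  \<comment> \<open>For \<open>x > 1\<close> the field on \<open>\<zeta> = 0\<close> points
    downwards, so the orbit cannot return.\<close>
  have neg: "\<zeta> s < 0" if s: "s \<ge> s2" for s
  proof (rule ccontr)
    assume "\<not> \<zeta> s < 0"
    then have *: "- \<zeta> s \<le> 0" by simp
    have "continuous_on {s2..s} (\<lambda>s. - \<zeta> s)" by (intro continuous_intros zeta_cont)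
    moreover have "- \<zeta> s2 > 0" using s2 by simp
    ultimately obtain t where t: "s2 < t" "- \<zeta> t = 0" "\<And>r. s2 \<le> r \<Longrightarrow> r < t \<Longrightarrow> - \<zeta> r > 0"
      using s * first_zero[where g = "\<lambda>s. - \<zeta> s" and a = s2 and b = s] by blast
    then have "\<zeta> t = 0" by simp
    have "- (d * (1 - x t)) \<le> 0"
      by (rule deriv_nonpos_at_first_zero[OF DERIV_minus[OF zeta_deriv_at_zero[OF \<open>\<zeta> t = 0\<close>]] t(2,1)])
         (use t(3) in auto)
    moreover have "d * (1 - x t) < 0" using d_pos x1[of t] t(1) s2(1) by (intro mult_pos_neg) (auto simp: a_def)
    ultimately show False by linarith
  qed
  have "\<exists>B>0. ((\<lambda>s. (1 - x s) * exp (2 * c1 * s)) \<longlongrightarrow> -1 * B) at_top"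
  proof (rule decay[of c _ s2])
    fix s assume s: "s2 \<le> s"
    then have "s > s1" using s2(1) by (simp add: a_def)
    then have x: "1 - x s < 0" using x1 by simp
    then show "-1 * (1 - x s) > 0" by simp
    show "0 < \<rho> s" using neg[OF s] x by (simp add: \<rho>_def zero_less_divide_iff)
    show "\<rho> s < c" using above[of s] \<open>s > s1\<close> x by (simp add: \<rho>_def neg_divide_less_eq mult.commute)
  qed (use c in auto)
  then show ?thesis by simp
qed

end

section \<open>Uniqueness of the orbit\<close>

text \<open>The system is autonomous, so a shift of \<open>s\<close> only rescales the start value;
  the shift by \<open>ln lam\<close> multiplies it by \<open>lam\<^sup>2\<close>.\<close>

lemma (in profile_system) translate:
  "profile_system p d \<kappa> (x0 * exp (2 * a)) (\<lambda>s. x (s + a)) (\<lambda>s. \<zeta> (s + a))"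
proof
  show "0 < p" "0 < d" "0 < \<kappa>" "0 < x0 * exp (2 * a)" "x (s + a) > 0" for s
    using p_pos d_pos kappa_pos x0_pos x_pos by auto
  show "((\<lambda>s. x (s + a)) has_real_derivative 2 * x (s + a) * \<zeta> (s + a)) (at s)" for s
    using x_deriv[of "s + a"] by (simp add: DERIV_shift)
  show "((\<lambda>s. \<zeta> (s + a)) has_real_derivative
      (1 - \<zeta> (s + a)) * (p * \<zeta> (s + a) + d) - x (s + a) * (d + \<kappa> * \<zeta> (s + a))) (at s)" for s
    using zeta_deriv[of "s + a"] by (simp add: DERIV_shift)
  have sh: "filterlim (\<lambda>s. s + a) at_bot at_bot"
    unfolding filterlim_at_bot eventually_at_bot_linorder
    by (intro allI exI[of _ "_ - a"]) (auto simp: algebra_simps)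
  have "((\<lambda>s. x (s + a) * exp (- 2 * (s + a)) * exp (2 * a)) \<longlongrightarrow> x0 * exp (2 * a)) at_bot"
    by (intro tendsto_intros filterlim_compose[OF x_start sh])
  then show "((\<lambda>s. x (s + a) * exp (- 2 * s)) \<longlongrightarrow> x0 * exp (2 * a)) at_bot"
    by (simp add: mult.assoc flip: exp_add)
  have "((\<lambda>s. (\<zeta> (s + a) - 1) * exp (- (s + a)) * exp a) \<longlongrightarrow> 0 * exp a) at_bot"
    by (intro tendsto_intros filterlim_compose[OF zeta_start sh])
  then show "((\<lambda>s. (\<zeta> (s + a) - 1) * exp (- s)) \<longlongrightarrow> 0) at_bot"
    by (simp add: mult.assoc flip: exp_add)
qed

text \<open>The saddle is reached only at minus infinity, so this is no ordinary initial value
  problem. The start conditions make weighted differences of the two orbits tend to 0 there, and a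
  Gronwall estimate from minus infinity keeps them 0.\<close>

lemma profile_unique:
  fixes p d \<kappa> x0 :: real
  assumes sys: "profile_system p d \<kappa> x0 x1 z1" "profile_system p d \<kappa> x0 x2 z2"
  shows "x1 T = x2 T"
proof -
  interpret P: profile_system p d \<kappa> x0 x1 z1 by fact
  interpret Q: profile_system p d \<kappa> x0 x2 z2 by fact
  have cz: "continuous_on UNIV (\<lambda>s. (z s - 1) * exp (- s))" if "continuous_on UNIV z" for z :: "real \<Rightarrow> real"
    by (intro continuous_intros that)
  obtain K1 where K1: "K1 > 0" "\<And>s. s \<le> T \<Longrightarrow> \<bar>(z1 s - 1) * exp (- s)\<bar> \<le> K1"
    using bounded_atMost_of_tendsto_at_bot[OF P.zeta_start cz[OF P.zeta_cont]] by metis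
  obtain K2 where K2: "K2 > 0" "\<And>s. s \<le> T \<Longrightarrow> \<bar>(z2 s - 1) * exp (- s)\<bar> \<le> K2"
    using bounded_atMost_of_tendsto_at_bot[OF Q.zeta_start cz[OF Q.zeta_cont]] by metis
  have "continuous_on UNIV (\<lambda>s. x2 s * exp (- 2 * s))" by (intro continuous_intros Q.x_cont)
  then obtain K3 where K3: "K3 > 0" "\<And>s. s \<le> T \<Longrightarrow> \<bar>x2 s * exp (- 2 * s)\<bar> \<le> K3"
    using bounded_atMost_of_tendsto_at_bot[OF Q.x_start] by metis
  \<comment> \<open>The weights make \<open>H' \<le> 2 * C * exp s * H\<close>, whose coefficient is integrable at \<open>-\<infinity>\<close>.\<close>
  define v where "v s = x1 s * exp (- 2 * s) - x2 s * exp (- 2 * s)" for s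
  define u where "u s = (z1 s - 1) * exp (- s) - (z2 s - 1) * exp (- s)" for s
  define X where "X s = x2 s * exp (- 2 * s)" for s
  define H where "H s = (v s)\<^sup>2 + (u s)\<^sup>2" for s
  define R where "R s = 2 * ((v s)\<^sup>2 * (z1 s - 1)) + 2 * (X s * exp s * (u s * v s))
      + (u s)\<^sup>2 * (p - d - 1 - p * (z1 s + z2 s))
      - exp s * (u s * v s * (d + \<kappa> * z1 s)) - exp s * exp s * X s * \<kappa> * (u s)\<^sup>2" for s
  have e2: "exp (- 2 * s) = inverse (exp s * exp s)" for s :: real
    by (simp add: exp_minus flip: exp_add)
  have zd: "z1 s - z2 s = exp s * u s" and xd: "x1 s - x2 s = exp s * exp s * v s"
    and x2: "x2 s = exp s * exp s * X s" for s
    unfolding u_def v_def X_def e2 by (simp_all add: exp_minus field_simps)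
  have dv: "(v has_real_derivative 2 * (v s * (z1 s - 1)) + 2 * (X s * exp s * u s)) (at s)" for s
  proof -
    have "(v has_real_derivative (2 * x1 s * z1 s - 2 * x2 s * z2 s - 2 * (x1 s - x2 s)) * exp (- 2 * s)) (at s)"
      unfolding v_def[abs_def]
      by (auto intro!: derivative_eq_intros P.x_deriv Q.x_deriv simp: algebra_simps)
    moreover have "2 * x1 s * z1 s - 2 * x2 s * z2 s - 2 * (x1 s - x2 s)
        = 2 * ((x1 s - x2 s) * (z1 s - 1)) + 2 * (x2 s * (z1 s - z2 s))" by (simp add: algebra_simps)
    moreover have "\<dots> * exp (- 2 * s) = 2 * (v s * (z1 s - 1)) + 2 * (X s * exp s * u s)"
      unfolding zd by (simp add: v_def X_def algebra_simps)
    ultimately show ?thesis by simp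
  qed
  have du: "(u has_real_derivative u s * (p - d - 1 - p * (z1 s + z2 s))
      - exp s * (v s * (d + \<kappa> * z1 s)) - exp s * exp s * X s * \<kappa> * u s) (at s)" for s
  proof -
    let ?F = "\<lambda>x z. (1 - z) * (p * z + d) - x * (d + \<kappa> * z)"
    have "(u has_real_derivative (?F (x1 s) (z1 s) - ?F (x2 s) (z2 s) - (z1 s - z2 s)) * exp (- s)) (at s)"
      unfolding u_def[abs_def]
      by (auto intro!: derivative_eq_intros P.zeta_deriv Q.zeta_deriv simp: algebra_simps)
    moreover have "?F (x1 s) (z1 s) - ?F (x2 s) (z2 s) - (z1 s - z2 s)
      = (z1 s - z2 s) * (p - d - 1 - p * (z1 s + z2 s)) - (x1 s - x2 s) * (d + \<kappa> * z1 s) - x2 s * \<kappa> * (z1 s - z2 s)"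
      by (simp add: algebra_simps)
    moreover have "\<dots> = exp s * (u s * (p - d - 1 - p * (z1 s + z2 s))
      - exp s * (v s * (d + \<kappa> * z1 s)) - exp s * exp s * X s * \<kappa> * u s)"
      unfolding zd xd unfolding x2 by (simp add: algebra_simps)
    moreover have "exp s * y * exp (- s) = y" for y :: real by (simp add: exp_minus)
    ultimately show ?thesis by (simp only:)
  qed
  have dH: "(H has_real_derivative 2 * R s) (at s)" for s
    unfolding H_def[abs_def] R_def
    by (rule derivative_eq_intros dv du refl)+ (simp add: algebra_simps power2_eq_square)
  \<comment> \<open>One summand for each of the estimates 1 to 4; each carries a factor
    \<open>exp s\<close>, thanks to the weights. The fifth term has a favourable sign.\<close>
  define C where "C = 2 * K1 + K3 + p * (K1 + K2) + (d + \<kappa> * (1 + exp T * K1))"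
  have RC: "R s \<le> C * exp s * H s" if s: "s \<le> T" for s
  proof -
    let ?E = "exp s"
    define a1 where "a1 = (z1 s - 1) * exp (- s)"
    define a2 where "a2 = (z2 s - 1) * exp (- s)"
    have z: "z1 s = 1 + ?E * a1" "z2 s = 1 + ?E * a2" by (simp_all add: a1_def a2_def exp_minus field_simps)
    have b: "\<bar>a1\<bar> \<le> K1" "\<bar>a2\<bar> \<le> K2" "\<bar>X s\<bar> \<le> K3"
      using K1(2)[OF s] K2(2)[OF s] K3(2)[OF s] by (simp_all add: a1_def a2_def X_def)
    have E: "?E > 0" "?E \<le> exp T" using s by auto
    have Hn: "H s \<ge> 0" and vH: "(v s)\<^sup>2 \<le> H s" and uH: "(u s)\<^sup>2 \<le> H s" by (auto simp: H_def)
    have uv: "\<bar>u s * v s\<bar> \<le> H s / 2"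
    proof -
      have "2 * \<bar>u s\<bar> * \<bar>v s\<bar> \<le> \<bar>u s\<bar>\<^sup>2 + \<bar>v s\<bar>\<^sup>2" by (rule sum_squares_bound)
      then show ?thesis by (simp add: H_def abs_mult)
    qed
    have 1: "2 * ((v s)\<^sup>2 * (z1 s - 1)) \<le> ?E * (2 * K1 * H s)"
    proof -
      have "(v s)\<^sup>2 * a1 \<le> (v s)\<^sup>2 * K1" using b(1) by (intro mult_left_mono) auto
      also have "\<dots> \<le> H s * K1" using vH K1(1) by (intro mult_right_mono) auto
      finally have "?E * ((v s)\<^sup>2 * a1) \<le> ?E * (H s * K1)" by (intro mult_left_mono) auto
      then show ?thesis unfolding z by (simp add: algebra_simps)
    qed
    have 2: "2 * (X s * ?E * (u s * v s)) \<le> ?E * (K3 * H s)"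
    proof -
      have "\<bar>X s\<bar> * \<bar>u s * v s\<bar> \<le> K3 * (H s / 2)" using b(3) uv by (intro mult_mono) auto
      then have "X s * (u s * v s) \<le> K3 * (H s / 2)"
        by (metis abs_ge_self abs_mult order_trans)
      then have "?E * (X s * (u s * v s)) \<le> ?E * (K3 * (H s / 2))" by (intro mult_left_mono) auto
      then show ?thesis by (simp add: algebra_simps)
    qed
    have 3: "(u s)\<^sup>2 * (p - d - 1 - p * (z1 s + z2 s)) \<le> ?E * (p * (K1 + K2) * H s)"
    proof -
      have "p * - (a1 + a2) \<le> p * (K1 + K2)" using b P.p_pos by (intro mult_left_mono) auto
      then have "?E * (p * - (a1 + a2)) \<le> ?E * (p * (K1 + K2))" by (rule mult_left_mono) simp
      then have "p - d - 1 - p * (z1 s + z2 s) \<le> ?E * (p * (K1 + K2))"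
        unfolding z using P.p_pos P.d_pos by (simp add: algebra_simps)
      then have "(u s)\<^sup>2 * (p - d - 1 - p * (z1 s + z2 s)) \<le> (u s)\<^sup>2 * (?E * (p * (K1 + K2)))"
        by (intro mult_left_mono) auto
      also have "\<dots> \<le> H s * (?E * (p * (K1 + K2)))"
        using uH P.p_pos K1(1) K2(1) by (intro mult_right_mono mult_nonneg_nonneg) auto
      finally show ?thesis by (simp add: algebra_simps)
    qed
    have 4: "- (?E * (u s * v s * (d + \<kappa> * z1 s))) \<le> ?E * ((d + \<kappa> * (1 + exp T * K1)) * H s)"
    proof -
      have "?E * \<bar>a1\<bar> \<le> exp T * K1" using E b K1 by (intro mult_mono) auto
      then have "\<bar>z1 s\<bar> \<le> 1 + exp T * K1"
        unfolding z using abs_triangle_ineq[of 1 "?E * a1"] by (simp add: abs_mult)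
      then have "\<kappa> * \<bar>z1 s\<bar> \<le> \<kappa> * (1 + exp T * K1)" using P.kappa_pos by (intro mult_left_mono) auto
      then have "\<bar>d + \<kappa> * z1 s\<bar> \<le> d + \<kappa> * (1 + exp T * K1)"
        using abs_triangle_ineq[of d "\<kappa> * z1 s"] P.d_pos P.kappa_pos unfolding abs_mult by linarith
      moreover have "\<bar>u s * v s\<bar> \<le> H s" using uv Hn by simp
      ultimately have "\<bar>u s * v s\<bar> * \<bar>d + \<kappa> * z1 s\<bar> \<le> H s * (d + \<kappa> * (1 + exp T * K1))"
        using Hn by (intro mult_mono) auto
      then have "\<bar>u s * v s * (d + \<kappa> * z1 s)\<bar> \<le> (d + \<kappa> * (1 + exp T * K1)) * H s"
        by (simp add: abs_mult mult.commute)
      then have "- (u s * v s * (d + \<kappa> * z1 s)) \<le> (d + \<kappa> * (1 + exp T * K1)) * H s" by linarith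
      then have "?E * - (u s * v s * (d + \<kappa> * z1 s)) \<le> ?E * ((d + \<kappa> * (1 + exp T * K1)) * H s)"
        by (intro mult_left_mono) auto
      then show ?thesis by simp
    qed
    have 5: "?E * ?E * X s * \<kappa> * (u s)\<^sup>2 \<ge> 0"
      using Q.x_pos[of s] P.kappa_pos by (auto simp: X_def)
    have "C * ?E * H s = ?E * (2 * K1 * H s) + ?E * (K3 * H s) + ?E * (p * (K1 + K2) * H s)
        + ?E * ((d + \<kappa> * (1 + exp T * K1)) * H s)" by (simp add: C_def algebra_simps)
    then show ?thesis using 1 2 3 4 5 unfolding R_def by linarith
  qed
  \<comment> \<open>The integrating factor tends to 1 at minus infinity and makes \<open>g\<close>
    nonincreasing; as \<open>g\<close> tends to 0 there, \<open>g T \<le> 0\<close>.\<close>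
  define g where "g s = H s * exp (- (2 * C * exp s))" for s
  have "C > 0" unfolding C_def
    using K1(1) K2(1) K3(1) P.p_pos P.d_pos P.kappa_pos by (intro add_pos_pos mult_pos_pos) auto
  have dec: "g T \<le> g s" if "s \<le> T" for s
  proof (rule DERIV_nonpos_imp_nonincreasing[OF that])
    fix r assume "s \<le> r" "r \<le> T"
    have "(g has_real_derivative (2 * (R r - C * exp r * H r)) * exp (- (2 * C * exp r))) (at r)"
      unfolding g_def[abs_def] by (auto intro!: derivative_eq_intros dH simp: algebra_simps)
    moreover have "(2 * (R r - C * exp r * H r)) * exp (- (2 * C * exp r)) \<le> 0"
      using RC[OF \<open>r \<le> T\<close>] by (simp add: mult_nonpos_nonneg)
    ultimately show "\<exists>y. (g has_real_derivative y) (at r) \<and> y \<le> 0" by blast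
  qed
  have "((\<lambda>s. H s) \<longlongrightarrow> (x0 - x0)\<^sup>2 + (0 - 0)\<^sup>2) at_bot"
    unfolding H_def v_def u_def
    by (intro tendsto_intros P.x_start Q.x_start P.zeta_start Q.zeta_start)
  moreover have "((\<lambda>s. exp (- (2 * C * exp s))) \<longlongrightarrow> exp (- (2 * C * 0))) at_bot"
    by (intro tendsto_intros exp_at_bot)
  ultimately have "(g \<longlongrightarrow> ((x0 - x0)\<^sup>2 + (0 - 0)\<^sup>2) * exp (- (2 * C * 0))) at_bot"
    unfolding g_def[abs_def] by (rule tendsto_mult)
  then have "(g \<longlongrightarrow> 0) at_bot" by simp
  moreover have "eventually (\<lambda>s. g T \<le> g s) at_bot"
    using eventually_le_at_bot[of T] by eventually_elim (rule dec)
  ultimately have "g T \<le> 0" by (rule tendsto_lowerbound) simp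
  then have "H T \<le> 0" by (simp add: g_def mult_le_0_iff)
  then have "v T = 0" unfolding H_def
    by (metis add_nonneg_nonneg order_antisym sum_power2_eq_zero_iff zero_le_power2)
  then show ?thesis by (simp add: v_def)
qed

section \<open>Radial functions\<close>

lemma partial_deriv_eq:
  assumes "(u has_derivative D) (at y)"
  shows "partial_deriv i u y = D (axis i 1)"
  using frechet_derivative_at[OF assms] by (simp add: partial_deriv_def)

lemma has_derivative_radial:
  fixes y :: "'a :: real_inner"
  assumes "y \<noteq> 0" "(g has_real_derivative g') (at (norm y))"
  shows "((\<lambda>z. g (norm z)) has_derivative (\<lambda>h. g' * (h \<bullet> sgn y))) (at y)"
  using has_derivative_compose[OF has_derivative_norm[OF assms(1)]
      assms(2)[unfolded has_field_derivative_def]] by simp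

lemma partial_deriv_radial:
  fixes y :: "real ^ 'n::finite"
  assumes "y \<noteq> 0" "(g has_real_derivative g') (at (norm y))"
  shows "partial_deriv i (\<lambda>z. g (norm z)) y = g' * (y $ i / norm y)"
  using partial_deriv_eq[OF has_derivative_radial[OF assms], of i]
  by (simp add: inner_axis' sgn_div_norm divide_inverse mult.commute)

text \<open>The gradient is \<open>q (norm z)\<close> times \<open>z\<close> with
  \<open>q = g1 / r\<close>, and \<open>q' = (g2 - q) / r\<close>. The result isolates
  \<open>(y $ i)\<^sup>2\<close>, ready for summation over \<open>i\<close>.\<close>

lemma partial_deriv2_radial:
  fixes y :: "real ^ 'n::finite"
  assumes g1: "\<And>r. r > 0 \<Longrightarrow> (g has_real_derivative g1 r) (at r)"
    and g2: "\<And>r. r > 0 \<Longrightarrow> (g1 has_real_derivative g2 r) (at r)" and y: "y \<noteq> 0"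
  shows "partial_deriv i (partial_deriv i (\<lambda>z. g (norm z))) y
    = (g2 (norm y) - g1 (norm y) / norm y) / (norm y)\<^sup>2 * (y $ i)\<^sup>2 + g1 (norm y) / norm y"
proof -
  define q where "q r = g1 r / r" for r
  have q: "(q has_real_derivative (g2 r - q r) / r) (at r)" if "r > 0" for r
    unfolding q_def[abs_def] using that
    by (auto intro!: derivative_eq_intros g2 simp: field_simps)
  have grad: "q (norm z) * z $ i = partial_deriv i (\<lambda>z. g (norm z)) z" if "z \<noteq> 0" for z :: "real ^ 'n"
    using partial_deriv_radial[OF that g1, of i] that by (simp add: q_def)
  have "((\<lambda>z. q (norm z) * z $ i) has_derivative
      (\<lambda>h. q (norm y) * h $ i + (g2 (norm y) - q (norm y)) / norm y * (h \<bullet> sgn y) * y $ i)) (at y)"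
    using y by (intro has_derivative_mult has_derivative_radial q bounded_linear.has_derivative[OF bounded_linear_vec_nth])
       (auto intro!: derivative_intros)
  then have "((partial_deriv i (\<lambda>z. g (norm z))) has_derivative
      (\<lambda>h. q (norm y) * h $ i + (g2 (norm y) - q (norm y)) / norm y * (h \<bullet> sgn y) * y $ i)) (at y)"
    by (rule has_derivative_transform_within_open[where s = "- {0}"]) (use y grad in auto)
  from partial_deriv_eq[OF this, of i]
  have "partial_deriv i (partial_deriv i (\<lambda>z. g (norm z))) y
     = q (norm y) + (g2 (norm y) - q (norm y)) / norm y * (y $ i / norm y) * y $ i"
    by (simp add: inner_axis' sgn_div_norm divide_inverse mult.commute)
  then show ?thesis by (simp add: q_def power2_eq_square)
qed

lemma sum_components_sq: "(\<Sum>i\<in>UNIV. (y $ i)\<^sup>2) = (norm (y :: real ^ 'n::finite))\<^sup>2"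
  unfolding power2_norm_eq_inner inner_vec_def by (simp add: power2_eq_square)

lemma laplacian_radial:
  fixes y :: "real ^ 'n::finite"
  assumes g1: "\<And>r. r > 0 \<Longrightarrow> (g has_real_derivative g1 r) (at r)"
    and g2: "\<And>r. r > 0 \<Longrightarrow> (g1 has_real_derivative g2 r) (at r)" and y: "y \<noteq> 0"
  shows "laplacian (\<lambda>z. g (norm z)) y
    = g2 (norm y) + (real CARD('n) - 1) / norm y * g1 (norm y)"
proof -
  have "partial_deriv i (partial_deriv i (\<lambda>z. g (norm z))) y
    = (g2 (norm y) - g1 (norm y) / norm y) / (norm y)\<^sup>2 * (y $ i)\<^sup>2 + g1 (norm y) / norm y" for i
    by (rule partial_deriv2_radial) (use assms in auto)
  note eq = this
  have "laplacian (\<lambda>z. g (norm z)) y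
    = (g2 (norm y) - g1 (norm y) / norm y) / (norm y)\<^sup>2 * (norm y)\<^sup>2 + real CARD('n) * (g1 (norm y) / norm y)"
    unfolding laplacian_def eq sum.distrib sum_distrib_left[symmetric] sum_components_sq by simp
  moreover have "(g2 (norm y) - g1 (norm y) / norm y) / (norm y)\<^sup>2 * (norm y)\<^sup>2 = g2 (norm y) - g1 (norm y) / norm y"
    using y by simp
  ultimately show ?thesis by (simp add: diff_divide_distrib algebra_simps)
qed

lemma inner_gradient_radial:
  fixes y :: "real ^ 'n::finite"
  assumes "y \<noteq> 0" "(g has_real_derivative g') (at (norm y))"
  shows "y \<bullet> gradient (\<lambda>z. g (norm z)) y = norm y * g'"
proof -
  have "y \<bullet> gradient (\<lambda>z. g (norm z)) y = (\<Sum>i\<in>UNIV. g' / norm y * (y $ i)\<^sup>2)"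
    by (simp add: gradient_def inner_vec_def partial_deriv_radial[OF assms] power2_eq_square mult_ac)
  also have "\<dots> = norm y * g'"
    unfolding sum_distrib_left[symmetric] sum_components_sq using assms(1) by (simp add: power2_eq_square)
  finally show ?thesis .
qed

section \<open>Restriction to an axis and the radial equation\<close>

lemma has_real_derivative_along_axis:
  fixes u :: "real ^ 'n::finite \<Rightarrow> real"
  assumes "u differentiable (at (t *\<^sub>R axis i 1))"
  shows "((\<lambda>t. u (t *\<^sub>R axis i 1)) has_real_derivative partial_deriv i u (t *\<^sub>R axis i 1)) (at t)"
proof -
  let ?D = "frechet_derivative u (at (t *\<^sub>R axis i 1))"
  have "((\<lambda>t. t *\<^sub>R axis i (1::real)) has_derivative (\<lambda>h. h *\<^sub>R axis i 1)) (at t)"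
    by (auto intro!: derivative_eq_intros)
  from has_derivative_compose[OF this assms[unfolded frechet_derivative_works]]
  have "((\<lambda>t. u (t *\<^sub>R axis i 1)) has_derivative (\<lambda>h. ?D (h *\<^sub>R axis i 1))) (at t)" .
  moreover have "?D (h *\<^sub>R axis i 1) = ?D (axis i 1) * h" for h
    using linear_frechet_derivative[OF assms] by (simp add: linear_cmul)
  ultimately show ?thesis by (simp add: has_field_derivative_def partial_deriv_def)
qed

text \<open>On a coordinate axis the solution is the even function \<open>f \<bar>t\<bar>\<close>,
  whose derivative at 0 vanishes by evenness. The absolute value is there because \<open>f\<close>
  is arbitrary at negative arguments.\<close>

lemma C2_radial_profile:
  fixes f :: "real \<Rightarrow> real"
  assumes "C2 (\<lambda>y :: real ^ 'n::finite. f (norm y))"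
  shows "\<exists>f1 f2. (\<forall>r>0. (f has_real_derivative f1 r) (at r)) \<and>
    (\<forall>r>0. (f1 has_real_derivative f2 r) (at r)) \<and>
    isCont f1 0 \<and> f1 0 = 0 \<and> isCont (\<lambda>t. f \<bar>t\<bar>) 0"
proof -
  fix i :: 'n
  let ?u = "\<lambda>y :: real ^ 'n. f (norm y)"
  define \<phi> where "\<phi> t = ?u (t *\<^sub>R axis i 1)" for t
  define f1 where "f1 t = partial_deriv i ?u (t *\<^sub>R axis i 1)" for t
  define f2 where "f2 t = partial_deriv i (partial_deriv i ?u) (t *\<^sub>R axis i 1)" for t
  have phi: "\<phi> t = f \<bar>t\<bar>" for t by (simp add: \<phi>_def)
  have d1: "(\<phi> has_real_derivative f1 t) (at t)" for t
    unfolding \<phi>_def[abs_def] f1_def using assms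
    by (intro has_real_derivative_along_axis) (auto simp: C2_def)
  have d2: "(f1 has_real_derivative f2 t) (at t)" for t
    unfolding f2_def f1_def[abs_def] using assms
    by (intro has_real_derivative_along_axis) (auto simp: C2_def)
  have "((\<lambda>t. \<phi> (- t)) has_real_derivative f1 (- 0) * - 1) (at 0)"
    by (rule DERIV_chain2[OF d1]) (auto intro!: derivative_eq_intros)
  moreover have "(\<lambda>t. \<phi> (- t)) = \<phi>" by (simp add: phi fun_eq_iff)
  ultimately have "(\<phi> has_real_derivative - f1 0) (at 0)" by simp
  then have "f1 0 = - f1 0" by (rule DERIV_unique[OF d1])
  then have zero: "f1 0 = 0" by simp
  have phi': "\<phi> = (\<lambda>t. f \<bar>t\<bar>)" by (intro ext phi)
  have der: "(f has_real_derivative f1 r) (at r)" if "r > 0" for r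
    by (rule has_field_derivative_transform_within_open[OF d1 open_greaterThan[of 0]]) (use that in \<open>auto simp: phi\<close>)
  have cont: "isCont (\<lambda>t. f \<bar>t\<bar>) 0"
    using DERIV_isCont[OF d1[of 0]] unfolding phi' .
  show ?thesis using der d2 DERIV_isCont[OF d2] zero cont by blast
qed

text \<open>The radial equation is multiplied by \<open>r\<^sup>2 / f r powr m\<close>. In the
  scale-invariant quantities \<open>\<xi>\<close> and \<open>\<omega>\<close> the powers of
  \<open>r\<close> disappear, so the equation becomes autonomous in \<open>ln r\<close>.\<close>

lemma radial_ode:
  fixes f f1 f2 :: "real \<Rightarrow> real"
  assumes sol: "elliptic_solution m \<alpha> \<beta> (\<lambda>y :: real ^ 'n::finite. f (norm y))"
    and f1: "\<And>r. r > 0 \<Longrightarrow> (f has_real_derivative f1 r) (at r)"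
    and f2: "\<And>r. r > 0 \<Longrightarrow> (f1 has_real_derivative f2 r) (at r)"
    and r: "r > 0"
  defines "\<xi> \<equiv> r * f1 r / f r" and "\<omega> \<equiv> r\<^sup>2 * f r powr (1 - m)"
  shows "m * (m - 1) * \<xi>\<^sup>2 + m * (r\<^sup>2 * f2 r / f r) + (real CARD('n) - 1) * m * \<xi> + \<omega> * (\<alpha> + \<beta> * \<xi>) = 0"
proof -
  fix i :: 'n
  define y where "y = r *\<^sub>R axis i (1::real)"
  have ny: "norm y = r" and y0: "y \<noteq> 0" using r by (auto simp: y_def)
  have fpos: "f r > 0" if "r > 0" for r
  proof -
    have "f (norm (r *\<^sub>R axis i (1::real))) > 0" using sol unfolding elliptic_solution_def by blast
    then show ?thesis using that by simp
  qed
  define g where "g t = f t powr m" for t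
  define g1 where "g1 t = m * f t powr (m - 1) * f1 t" for t
  define g2 where "g2 t = m * ((m - 1) * f t powr (m - 2) * f1 t * f1 t + f t powr (m - 1) * f2 t)" for t
  have dpow: "((\<lambda>t. f t powr a) has_real_derivative a * f t powr (a - 1) * f1 t) (at t)" if "t > 0" for a t
    by (rule DERIV_chain2[OF has_real_derivative_powr f1]) (use that fpos in auto)
  have dg: "(g has_real_derivative g1 t) (at t)" if "t > 0" for t
    using dpow[OF that] by (simp add: g_def[abs_def] g1_def)
  have dg1: "(g1 has_real_derivative g2 t) (at t)" if "t > 0" for t
    unfolding g1_def[abs_def] g2_def
    by (rule derivative_eq_intros dpow f2 that refl)+ (simp add: algebra_simps)
  have "laplacian (\<lambda>z. g (norm z)) y + \<alpha> * f (norm y) + \<beta> * (y \<bullet> gradient (\<lambda>z. f (norm z)) y) = 0"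
    using sol by (simp add: elliptic_solution_def g_def)
  moreover have "laplacian (\<lambda>z. g (norm z)) y = g2 r + (real CARD('n) - 1) / r * g1 r"
    using laplacian_radial[of g g1 g2 y] dg dg1 y0 by (simp add: ny)
  moreover have "y \<bullet> gradient (\<lambda>z. f (norm z)) y = r * f1 r"
    using inner_gradient_radial[OF y0, of f "f1 r"] f1[OF r] by (simp add: ny)
  ultimately have eq: "g2 r + (real CARD('n) - 1) / r * g1 r + \<alpha> * f r + \<beta> * (r * f1 r) = 0"
    by (simp add: ny)
  define F where "F = f r"
  have F: "F > 0" using fpos r by (simp add: F_def)
  define M where "M = F powr m"
  have M: "M > 0" using F by (simp add: M_def)
  have p1: "F powr (m - 1) = M / F" and p2: "F powr (m - 2) = M / (F * F)" and p3: "F powr (1 - m) = F / M"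
    using F by (simp_all add: M_def powr_diff powr_numeral power2_eq_square)
  have nz: "F \<noteq> 0" "M \<noteq> 0" "r \<noteq> 0" using F M r by auto
  have t1: "r\<^sup>2 / M * g2 r = m * (m - 1) * (r * f1 r / F)\<^sup>2 + m * (r\<^sup>2 * f2 r / F)"
  proof -
    have "r\<^sup>2 / M * (m * ((m - 1) * (M / (F * F)) * a * a + M / F * b))
      = m * (m - 1) * (r * a / F)\<^sup>2 + m * (r\<^sup>2 * b / F)" for a b
      using nz by (simp add: distrib_left power2_eq_square mult_ac)
    then show ?thesis unfolding g2_def F_def[symmetric] p1 p2 .
  qed
  have t2: "r\<^sup>2 / M * (k / r * g1 r) = k * m * (r * f1 r / F)" for k
  proof -
    have "r\<^sup>2 / M * (k / r * (m * (M / F) * a)) = k * m * (r * a / F)" for a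
      using nz by (simp add: power2_eq_square)
    then show ?thesis unfolding g1_def F_def[symmetric] p1 .
  qed
  have t3: "r\<^sup>2 / M * (\<alpha> * F) + r\<^sup>2 / M * (\<beta> * (r * f1 r)) = r\<^sup>2 * (F / M) * (\<alpha> + \<beta> * (r * f1 r / F))"
    using nz by (simp add: distrib_left)
  have "r\<^sup>2 / M * (g2 r + (real CARD('n) - 1) / r * g1 r + \<alpha> * F + \<beta> * (r * f1 r)) = 0"
    using eq by (simp add: F_def)
  then have "r\<^sup>2 / M * g2 r + r\<^sup>2 / M * ((real CARD('n) - 1) / r * g1 r)
     + (r\<^sup>2 / M * (\<alpha> * F) + r\<^sup>2 / M * (\<beta> * (r * f1 r))) = 0"
    by (simp only: distrib_left add.assoc)
  then show ?thesis unfolding t1 t2 t3 \<xi>_def \<omega>_def F_def[symmetric] p3 .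
qed

section \<open>Reduction of the elliptic equation\<close>

text \<open>With \<open>\<eta>\<close> for \<open>r\<^sup>2 * f'' / f\<close>, the left side is the
  derivative of \<open>\<zeta>\<close> in \<open>ln r\<close>, since
  \<open>\<xi>' = \<xi> + \<eta> - \<xi>\<^sup>2\<close>. The key identities are
  \<open>p + d = n - 2\<close> and
  \<open>d + \<kappa> = N * ((2 * \<beta> + 1) / (1 - m))\<close>.\<close>

lemma profile_algebra:
  fixes m n \<beta> \<xi> \<eta> \<omega> :: real
  defines "N \<equiv> n - 2 - n * m"
  defines "p \<equiv> 2 * m / (1 - m)" and "d \<equiv> N / (1 - m)" and "\<kappa> \<equiv> 2 * \<beta> * N / (1 - m)"
    and "C \<equiv> 2 * m * N / (1 - m)" and "\<zeta> \<equiv> 1 + (1 - m) / 2 * \<xi>"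
  assumes m: "0 < m" "m < 1" and N: "N \<noteq> 0"
    and eq: "m * (m - 1) * \<xi>\<^sup>2 + m * \<eta> + (n - 1) * m * \<xi> + \<omega> * ((2 * \<beta> + 1) / (1 - m) + \<beta> * \<xi>) = 0"
  shows "(1 - m) / 2 * (\<xi> + \<eta> - \<xi>\<^sup>2) = (1 - \<zeta>) * (p * \<zeta> + d) - \<omega> / C * (d + \<kappa> * \<zeta>)"
proof -
  have nz: "m \<noteq> 0" "1 - m \<noteq> 0" using m by auto
  have pm: "p * ((1 - m) / 2) = m" and km: "\<kappa> * ((1 - m) / 2) = \<beta> * N"
    unfolding p_def \<kappa>_def using nz by simp_all
  have "2 * m + N = (n - 2) * (1 - m)" "N + 2 * \<beta> * N = N * (2 * \<beta> + 1)"
    unfolding N_def by (simp_all add: algebra_simps)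
  then have pd: "p + d = n - 2" and kd: "d + \<kappa> = N * ((2 * \<beta> + 1) / (1 - m))"
    unfolding p_def d_def \<kappa>_def add_divide_distrib[symmetric] using nz by simp_all
  have "p * \<zeta> + d = p + d + p * ((1 - m) / 2) * \<xi>"
    unfolding \<zeta>_def by (simp add: distrib_left)
  then have 1: "p * \<zeta> + d = n - 2 + m * \<xi>" unfolding pd pm .
  have "d + \<kappa> * \<zeta> = d + \<kappa> + \<kappa> * ((1 - m) / 2) * \<xi>"
    unfolding \<zeta>_def by (simp add: distrib_left)
  then have "d + \<kappa> * \<zeta> = N * ((2 * \<beta> + 1) / (1 - m) + \<beta> * \<xi>)"
    unfolding kd km by (simp add: distrib_left mult_ac)
  then have 2: "\<omega> / C * (d + \<kappa> * \<zeta>) = (1 - m) / (2 * m) * (\<omega> * ((2 * \<beta> + 1) / (1 - m) + \<beta> * \<xi>))"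
    unfolding C_def using nz N by simp
  have 3: "\<omega> * ((2 * \<beta> + 1) / (1 - m) + \<beta> * \<xi>) = - (m * ((m - 1) * \<xi>\<^sup>2 + \<eta> + (n - 1) * \<xi>))"
    using eq by (simp add: algebra_simps)
  have "(1 - m) / (2 * m) * - (m * ((m - 1) * \<xi>\<^sup>2 + \<eta> + (n - 1) * \<xi>))
      = - ((1 - m) / 2 * ((m - 1) * \<xi>\<^sup>2 + \<eta> + (n - 1) * \<xi>))"
    using nz by simp
  with 2 3 have 4: "\<omega> / C * (d + \<kappa> * \<zeta>) = - ((1 - m) / 2 * ((m - 1) * \<xi>\<^sup>2 + \<eta> + (n - 1) * \<xi>))"
    by (simp only:)
  have z: "1 - \<zeta> = - ((1 - m) / 2 * \<xi>)" by (simp add: \<zeta>_def)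
  have "- (k * \<xi>) * (n - 2 + m * \<xi>) - - (k * ((m - 1) * \<xi>\<^sup>2 + \<eta> + (n - 1) * \<xi>)) = k * (\<xi> + \<eta> - \<xi>\<^sup>2)" for k
    by (simp add: algebra_simps power2_eq_square)
  then show ?thesis by (simp only: 1 4 z)
qed

lemma radial_solution_pos:
  assumes "radial_solution TYPE('n::finite) m \<alpha> \<beta> lam f" "r \<ge> 0"
  shows "f r > 0"
proof -
  \<comment> \<open>\<open>undefined\<close> is an arbitrary index; any coordinate axis
    serves.\<close>
  have "f (norm (r *\<^sub>R axis (undefined :: 'n) (1::real))) > 0"
    using assms(1) unfolding radial_solution_def elliptic_solution_def by blast
  then show ?thesis using assms(2) by simp
qed

text \<open>The start conditions encode the data at the origin: \<open>x s * exp (- 2 * s)\<close>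
  is \<open>f powr (1 - m) / C\<close>, with limit fixed by \<open>f 0\<close>, and
  \<open>(\<zeta> s - 1) * exp (- s)\<close> is \<open>(1 - m) / 2 * (f' / f)\<close>, which tends
  to 0 since \<open>f'\<close> vanishes at 0.\<close>

lemma profile_system_of_solution:
  fixes f :: "real \<Rightarrow> real" and n :: nat and m \<alpha> \<beta> lam :: real
  defines "N \<equiv> real n - 2 - real n * m"
  assumes n: "n = CARD('n::finite)" and m: "0 < m" "m < 1" and N: "0 < N" and \<beta>: "0 < \<beta>"
    and \<alpha>: "\<alpha> = (2 * \<beta> + 1) / (1 - m)" and lam: "lam > 0"
    and sol: "radial_solution TYPE('n) m \<alpha> \<beta> lam f"
  obtains \<zeta> where "profile_system (2 * m / (1 - m)) (N / (1 - m)) (2 * \<beta> * N / (1 - m)) (lam\<^sup>2 / C_star n m)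
    (\<lambda>s. (exp s)\<^sup>2 * f (exp s) powr (1 - m) / C_star n m) \<zeta>"
proof -
  have ell: "elliptic_solution m \<alpha> \<beta> (\<lambda>y :: real ^ 'n. f (norm y))" and f0: "f 0 = lam powr (2 / (1 - m))"
    using sol by (auto simp: radial_solution_def)
  then have "C2 (\<lambda>y :: real ^ 'n. f (norm y))" by (simp add: elliptic_solution_def)
  then obtain f1 f2 where f1: "\<And>r. r > 0 \<Longrightarrow> (f has_real_derivative f1 r) (at r)"
    and f2: "\<And>r. r > 0 \<Longrightarrow> (f1 has_real_derivative f2 r) (at r)"
    and c1: "isCont f1 0" "f1 0 = 0" and c0: "isCont (\<lambda>t. f \<bar>t\<bar>) 0"
    using C2_radial_profile[of f] by blast
  have fpos: "f r > 0" if "r \<ge> 0" for r using radial_solution_pos[OF sol that] .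
  define C where "C = C_star n m"
  have C: "C = 2 * m * N / (1 - m)" by (simp add: C_def C_star_def N_def)
  have Cpos: "C > 0" using m N by (simp add: C)
  define \<xi> where "\<xi> s = exp s * f1 (exp s) / f (exp s)" for s
  define \<zeta> where "\<zeta> s = 1 + (1 - m) / 2 * \<xi> s" for s
  define x where "x s = (exp s)\<^sup>2 * f (exp s) powr (1 - m) / C" for s
  have df: "((\<lambda>s. f (exp s)) has_real_derivative f1 (exp s) * exp s) (at s)" for s
    by (rule DERIV_chain2[OF f1 DERIV_exp]) simp
  have df1: "((\<lambda>s. f1 (exp s)) has_real_derivative f2 (exp s) * exp s) (at s)" for s
    by (rule DERIV_chain2[OF f2 DERIV_exp]) simp
  have dpow: "((\<lambda>s. f (exp s) powr (1 - m)) has_real_derivative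
      (1 - m) * f (exp s) powr (1 - m) * \<xi> s) (at s)" for s
  proof -
    have "((\<lambda>s. f (exp s) powr (1 - m)) has_real_derivative
        (1 - m) * f (exp s) powr (1 - m - 1) * (f1 (exp s) * exp s)) (at s)"
      by (rule DERIV_chain2[OF has_real_derivative_powr df]) (use fpos in auto)
    moreover have P: "f (exp s) powr (a - 1) = f (exp s) powr a / f (exp s)" for a
      using fpos[of "exp s"] by (simp add: powr_diff)
    have "(1 - m) * f (exp s) powr (1 - m - 1) * (f1 (exp s) * exp s) = (1 - m) * f (exp s) powr (1 - m) * \<xi> s"
      unfolding P[of "1 - m"] \<xi>_def by (simp add: mult_ac)
    ultimately show ?thesis by (simp only:)
  qed
  have dx: "(x has_real_derivative 2 * x s * \<zeta> s) (at s)" for s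
  proof -
    have "((\<lambda>s. (exp s)\<^sup>2) has_real_derivative 2 * (exp s)\<^sup>2) (at s)"
      by (auto intro!: derivative_eq_intros simp: power2_eq_square)
    from DERIV_cdivide[OF DERIV_mult[OF this dpow], of C]
    have "(x has_real_derivative (2 * (exp s)\<^sup>2 * f (exp s) powr (1 - m)
        + (1 - m) * f (exp s) powr (1 - m) * \<xi> s * (exp s)\<^sup>2) / C) (at s)"
      by (simp add: x_def[abs_def])
    moreover have "(2 * E * P + (1 - m) * P * X * E) / C = 2 * (E * P / C) * (1 + (1 - m) / 2 * X)" for E P X
      using Cpos by (simp add: field_simps)
    ultimately show ?thesis by (simp only: x_def \<zeta>_def)
  qed
  have d\<xi>: "(\<xi> has_real_derivative \<xi> s + (exp s)\<^sup>2 * f2 (exp s) / f (exp s) - (\<xi> s)\<^sup>2) (at s)" for s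
  proof -
    have F: "f (exp s) \<noteq> 0" using fpos[of "exp s"] by simp
    have "(\<xi> has_real_derivative ((exp s * f1 (exp s) + f2 (exp s) * exp s * exp s) * f (exp s)
        - exp s * f1 (exp s) * (f1 (exp s) * exp s)) / (f (exp s) * f (exp s))) (at s)"
      unfolding \<xi>_def[abs_def] by (rule DERIV_divide[OF DERIV_mult[OF DERIV_exp df1] df F])
    moreover have "((E * a + b * E * E) * F - E * a * (a * E)) / (F * F) = E * a / F + E\<^sup>2 * b / F - (E * a / F)\<^sup>2"
      if "F \<noteq> 0" for E a b F :: real
      using that by (simp add: field_simps power2_eq_square)
    ultimately show ?thesis using F unfolding \<xi>_def by simp
  qed
  have d\<zeta>: "(\<zeta> has_real_derivative (1 - \<zeta> s) * (2 * m / (1 - m) * \<zeta> s + N / (1 - m))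
      - x s * (N / (1 - m) + 2 * \<beta> * N / (1 - m) * \<zeta> s)) (at s)" for s
  proof -
    have "(\<zeta> has_real_derivative (1 - m) / 2 * (\<xi> s + (exp s)\<^sup>2 * f2 (exp s) / f (exp s) - (\<xi> s)\<^sup>2)) (at s)"
      unfolding \<zeta>_def[abs_def] by (auto intro!: derivative_eq_intros d\<xi>)
    moreover have "m * (m - 1) * (\<xi> s)\<^sup>2 + m * ((exp s)\<^sup>2 * f2 (exp s) / f (exp s)) + (real n - 1) * m * \<xi> s
        + (exp s)\<^sup>2 * f (exp s) powr (1 - m) * ((2 * \<beta> + 1) / (1 - m) + \<beta> * \<xi> s) = 0"
      using radial_ode[OF ell, of f1 f2 "exp s"] f1 f2 by (simp add: n \<alpha> \<xi>_def)
    from profile_algebra[OF m _ this] N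
    have "(1 - m) / 2 * (\<xi> s + (exp s)\<^sup>2 * f2 (exp s) / f (exp s) - (\<xi> s)\<^sup>2)
       = (1 - \<zeta> s) * (2 * m / (1 - m) * \<zeta> s + N / (1 - m))
      - x s * (N / (1 - m) + 2 * \<beta> * N / (1 - m) * \<zeta> s)"
      unfolding \<zeta>_def x_def C N_def by simp
    ultimately show ?thesis by (simp only:)
  qed
  have lim0: "((\<lambda>s. f (exp s)) \<longlongrightarrow> f 0) at_bot"
    using isCont_tendsto_compose[OF c0 exp_at_bot] by simp
  have lim1: "((\<lambda>s. f1 (exp s)) \<longlongrightarrow> 0) at_bot"
    using isCont_tendsto_compose[OF c1(1) exp_at_bot] by (simp add: c1(2))
  have "profile_system (2 * m / (1 - m)) (N / (1 - m)) (2 * \<beta> * N / (1 - m)) (lam\<^sup>2 / C) x \<zeta>"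
  proof
    show "0 < 2 * m / (1 - m)" "0 < N / (1 - m)" "0 < 2 * \<beta> * N / (1 - m)" "0 < lam\<^sup>2 / C"
      using m N \<beta> lam Cpos by auto
    show "x s > 0" for s using fpos[of "exp s"] Cpos by (simp add: x_def)
    show "(x has_real_derivative 2 * x s * \<zeta> s) (at s)" for s by (rule dx)
    show "(\<zeta> has_real_derivative (1 - \<zeta> s) * (2 * m / (1 - m) * \<zeta> s + N / (1 - m))
      - x s * (N / (1 - m) + 2 * \<beta> * N / (1 - m) * \<zeta> s)) (at s)" for s by (rule d\<zeta>)
    have "((\<lambda>s. f (exp s) powr (1 - m) / C) \<longlongrightarrow> f 0 powr (1 - m) / C) at_bot"
      using fpos[of 0] Cpos by (intro tendsto_intros lim0) auto
    moreover have "f 0 powr (1 - m) = lam\<^sup>2"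
    proof -
      have "2 / (1 - m) * (1 - m) = 2" using m by (simp add: divide_eq_eq)
      then have "f 0 powr (1 - m) = lam powr 2" by (simp only: f0 powr_powr)
      then show ?thesis using lam by (simp add: powr_numeral)
    qed
    moreover have "f (exp s) powr (1 - m) / C = x s * exp (- 2 * s)" for s
    proof -
      have "exp (- 2 * s) = inverse ((exp s)\<^sup>2)"
        by (simp add: exp_minus power2_eq_square flip: exp_add)
      then show ?thesis by (simp add: x_def)
    qed
    ultimately show "((\<lambda>s. x s * exp (- 2 * s)) \<longlongrightarrow> lam\<^sup>2 / C) at_bot" by simp
    have "((\<lambda>s. (1 - m) / 2 * (f1 (exp s) / f (exp s))) \<longlongrightarrow> (1 - m) / 2 * (0 / f 0)) at_bot"
      using fpos[of 0] by (intro tendsto_intros lim0 lim1) auto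
    moreover have "(1 - m) / 2 * (f1 (exp s) / f (exp s)) = (\<zeta> s - 1) * exp (- s)" for s
      by (simp add: \<zeta>_def \<xi>_def exp_minus)
    ultimately show "((\<lambda>s. (\<zeta> s - 1) * exp (- s)) \<longlongrightarrow> 0) at_bot" by simp
  qed
  then show ?thesis using that unfolding x_def C_def by blast
qed

text \<open>As \<open>f = (C / r\<^sup>2) powr \<theta> * x powr \<theta>\<close> with
  \<open>\<theta> = 1 / (1 - m)\<close>, a first-order expansion of
  \<open>(1 - e) powr \<theta>\<close> at \<open>e = 0\<close> turns the limit \<open>b\<close> into
  the coefficient \<open>- (b / (1 - m))\<close>.\<close>

lemma decay_expansion_of_tendsto:
  fixes f :: "real \<Rightarrow> real" and n :: nat and m \<gamma> b :: real
  defines "x \<equiv> \<lambda>s. (exp s)\<^sup>2 * f (exp s) powr (1 - m) / C_star n m"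
  assumes m: "m < 1" and C: "C_star n m > 0" and fpos: "\<And>r. r > 0 \<Longrightarrow> f r > 0" and \<gamma>: "\<gamma> > 0"
    and lim: "((\<lambda>s. (1 - x s) * exp (\<gamma> * s)) \<longlongrightarrow> b) at_top"
  shows "decay_expansion n m \<gamma> (- (b / (1 - m))) f"
proof -
  define \<theta> where "\<theta> = 1 / (1 - m)"
  define \<epsilon> where "\<epsilon> s = 1 - x s" for s
  have lim': "((\<lambda>s. \<epsilon> s * exp (\<gamma> * s)) \<longlongrightarrow> b) at_top" using lim by (simp add: \<epsilon>_def)
  have elim: "((\<lambda>s. exp (- \<gamma> * s)) \<longlongrightarrow> 0) at_top"
    using \<gamma> by (intro filterlim_compose[OF exp_at_bot] filterlim_tendsto_neg_mult_at_bot[OF tendsto_const])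
      (auto simp: filterlim_ident)
  have "((\<lambda>s. \<epsilon> s * exp (\<gamma> * s) * exp (- \<gamma> * s)) \<longlongrightarrow> b * 0) at_top"
    by (intro tendsto_mult lim' elim)
  then have e0: "(\<epsilon> \<longlongrightarrow> 0) at_top" by (simp add: mult.assoc flip: exp_add)
  have "((\<lambda>e. (1 - e) powr \<theta>) has_real_derivative \<theta> * (1 - 0) powr (\<theta> - 1) * - 1) (at (0::real))"
    by (rule DERIV_chain2[OF has_real_derivative_powr]) (auto intro!: derivative_eq_intros)
  \<comment> \<open>Caratheodory's form of the derivative avoids division by
    \<open>\<epsilon>\<close>, which might vanish.\<close>
  then obtain q where q: "\<And>e::real. (1 - e) powr \<theta> - 1 = q e * e" "isCont q 0" "q 0 = - \<theta>"
    unfolding CARAT_DERIV by auto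
  have qlim: "((\<lambda>s. q (\<epsilon> s)) \<longlongrightarrow> - \<theta>) at_top"
    using isCont_tendsto_compose[OF q(2) e0] by (simp add: q(3))
  define h where "h r = x (ln r) powr \<theta> - 1 - (- (b / (1 - m))) * r powr - \<gamma>" for r
  have "((\<lambda>s. q (\<epsilon> s) * (\<epsilon> s * exp (\<gamma> * s)) + \<theta> * b) \<longlongrightarrow> - \<theta> * b + \<theta> * b) at_top"
    by (intro tendsto_intros qlim lim')
  then have "((\<lambda>s. q (\<epsilon> s) * (\<epsilon> s * exp (\<gamma> * s)) + \<theta> * b) \<longlongrightarrow> 0) at_top" by simp
  from filterlim_compose[OF this ln_at_top]
  have hl: "((\<lambda>r. q (\<epsilon> (ln r)) * (\<epsilon> (ln r) * exp (\<gamma> * ln r)) + \<theta> * b) \<longlongrightarrow> 0) at_top" .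
  have "eventually (\<lambda>r. q (\<epsilon> (ln r)) * (\<epsilon> (ln r) * exp (\<gamma> * ln r)) + \<theta> * b = h r / r powr - \<gamma>) at_top"
    using eventually_gt_at_top[of 0]
  proof eventually_elim
    case (elim r)
    have "x (ln r) powr \<theta> - 1 = q (\<epsilon> (ln r)) * \<epsilon> (ln r)" using q(1)[of "\<epsilon> (ln r)"] by (simp add: \<epsilon>_def)
    moreover have "exp (\<gamma> * ln r) = 1 / r powr - \<gamma>" using elim by (simp add: powr_def exp_minus field_simps)
    moreover have "r powr - \<gamma> > 0" using elim by simp
    ultimately show ?case by (simp add: h_def \<theta>_def field_simps)
  qed
  from Lim_transform_eventually[OF hl this] have "h \<in> o[at_top](\<lambda>r. r powr - \<gamma>)"
    by (rule smalloI_tendsto) (use eventually_gt_at_top[of 0] in \<open>auto elim!: eventually_mono\<close>)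
  moreover have "\<forall>\<^sub>F r in at_top. f r = (C_star n m / r\<^sup>2) powr (1 / (1 - m)) * (1 + - (b / (1 - m)) * r powr - \<gamma> + h r)"
    using eventually_gt_at_top[of 0]
  proof eventually_elim
    case (elim r)
    have "C_star n m / r\<^sup>2 * x (ln r) = f r powr (1 - m)"
      using elim C by (simp add: x_def)
    moreover have "(f r powr (1 - m)) powr \<theta> = f r"
      using fpos[OF elim] m by (simp add: powr_powr \<theta>_def)
    moreover have "x (ln r) \<ge> 0" using C fpos[OF elim] by (simp add: x_def)
    ultimately have "f r = (C_star n m / r\<^sup>2) powr \<theta> * x (ln r) powr \<theta>"
      using C by (metis divide_nonneg_nonneg less_imp_le powr_mult zero_le_power2)
    then show ?case by (simp add: h_def \<theta>_def)
  qed
  ultimately show ?thesis unfolding decay_expansion_def by blast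
qed

text \<open>By uniqueness the second orbit is the first one shifted by \<open>ln lam\<close>.
  Rewriting \<open>exp (\<gamma> * s)\<close> in the shifted variable produces the factor
  \<open>lam powr - \<gamma>\<close>.\<close>

lemma ratio_of_translate:
  assumes sys: "profile_system p d \<kappa> x0 x \<zeta>"
    and sys': "profile_system p d \<kappa> (x0 * lam\<^sup>2) x' \<zeta>'"
    and lam: "lam > 0"
    and lim: "((\<lambda>s. (1 - x s) * exp (\<gamma> * s)) \<longlongrightarrow> b) at_top"
  shows "((\<lambda>s. (1 - x' s) * exp (\<gamma> * s)) \<longlongrightarrow> b * lam powr - \<gamma>) at_top"
proof -
  have "exp (2 * ln lam) = lam\<^sup>2" using lam by (simp add: exp_double)
  then have "x' s = x (s + ln lam)" for s
    using profile_unique[OF sys'] profile_system.translate[OF sys, of "ln lam"] by simp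
  moreover have "filterlim (\<lambda>s. s + ln lam) at_top at_top"
    unfolding filterlim_at_top eventually_at_top_linorder
    by (intro allI exI[of _ "_ - ln lam"]) (auto simp: algebra_simps)
  from filterlim_compose[OF lim this]
  have "((\<lambda>s. (1 - x (s + ln lam)) * exp (\<gamma> * (s + ln lam)) * lam powr - \<gamma>) \<longlongrightarrow> b * lam powr - \<gamma>) at_top"
    by (intro tendsto_intros)
  moreover have "exp (\<gamma> * (s + ln lam)) * lam powr - \<gamma> = exp (\<gamma> * s)" for s
    using lam by (simp add: powr_def algebra_simps flip: exp_add)
  ultimately show ?thesis by (simp add: mult.assoc)
qed

text \<open>\<open>\<beta> > beta2 n m\<close> says precisely that \<open>A0\<close> exceeds the
  square root of \<open>8 * N * (1 - m)\<close>, so the quadratic has two distinct positive roots.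
  The slopes are half the exponents because \<open>x'\<close> carries a factor 2.\<close>

lemma node_roots:
  fixes n :: nat and m \<beta> :: real
  defines "N \<equiv> real n - 2 - real n * m"
  assumes m: "0 < m" "m < 1" and N: "0 < N" and \<beta>: "\<beta> > beta2 n m"
  obtains c1 c2 where "0 < c1" "c1 < c2" "N / (1 - m) = 2 * c1 * c2"
    "N / (1 - m) - 2 * m / (1 - m) + 2 * \<beta> * N / (1 - m) = 2 * (c1 + c2)"
    "gamma_exp 1 n m \<beta> = 2 * c1" "gamma_exp 2 n m \<beta> = 2 * c2"
proof -
  define A where "A = A0 n m \<beta>"
  define S where "S = sqrt (A\<^sup>2 - 8 * N * (1 - m))"
  have A: "A = N - 2 * m + 2 * \<beta> * N" by (simp add: A_def A0_def N_def algebra_simps)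
  have "2 * N * sqrt (2 * (1 - m) / N) = sqrt (8 * N * (1 - m))"
  proof -
    have "8 * N * (1 - m) = (2 * N)\<^sup>2 * (2 * (1 - m) / N)" using N by (simp add: power2_eq_square)
    then have "sqrt (8 * N * (1 - m)) = sqrt ((2 * N)\<^sup>2) * sqrt (2 * (1 - m) / N)"
      by (simp only: real_sqrt_mult)
    moreover have "sqrt ((2 * N)\<^sup>2) = 2 * N" using N by (intro real_sqrt_abs[THEN trans]) simp
    ultimately show ?thesis by (simp only:)
  qed
  moreover have "2 * N * beta2 n m = 2 * N * sqrt (2 * (1 - m) / N) + ((real n + 2) * m - (real n - 2))"
    unfolding beta2_def N_def[symmetric] using N by (simp add: distrib_left)
  moreover have "2 * N * beta2 n m < 2 * N * \<beta>" using \<beta> N by simp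
  ultimately have gt: "sqrt (8 * N * (1 - m)) < A" unfolding A by (simp add: N_def algebra_simps)
  have nn: "0 \<le> 8 * N * (1 - m)" using m N by simp
  have A0: "A > 0" using gt real_sqrt_ge_zero[OF nn] by linarith
  have "8 * N * (1 - m) < A\<^sup>2"
    using gt A0 by (metis less_imp_le real_sqrt_less_iff real_sqrt_unique)
  then have S: "S > 0" "S\<^sup>2 = A\<^sup>2 - 8 * N * (1 - m)" by (simp_all add: S_def)
  have "S\<^sup>2 < A\<^sup>2" using S m N by simp
  then have SA: "S < A" using A0 by (simp add: power_less_imp_less_base)
  have m1: "1 - m > 0" using m by simp
  show ?thesis
  proof (rule that[of "(A - S) / (4 * (1 - m))" "(A + S) / (4 * (1 - m))"])
    show "0 < (A - S) / (4 * (1 - m))" using SA m1 by simp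
    show "(A - S) / (4 * (1 - m)) < (A + S) / (4 * (1 - m))" using S m1 by (simp add: divide_strict_right_mono)
    have "(A - S) * (A + S) = 8 * N * (1 - m)" using S(2) by (simp add: algebra_simps power2_eq_square)
    moreover have "2 * (a / (4 * k)) * (b / (4 * k)) = a * b / (8 * k * k)" for a b k :: real
      by simp
    ultimately have "2 * ((A - S) / (4 * (1 - m))) * ((A + S) / (4 * (1 - m))) = 8 * N * (1 - m) / (8 * (1 - m) * (1 - m))"
      by (simp only:)
    also have "\<dots> = N / (1 - m)"
    proof -
      have "8 * a * b / (8 * b * b) = a / b" for a b :: real by simp
      then show ?thesis .
    qed
    finally show "N / (1 - m) = 2 * ((A - S) / (4 * (1 - m))) * ((A + S) / (4 * (1 - m)))" by (rule sym)
    have "N / k - 2 * m / k + 2 * \<beta> * N / k = A / k" for k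
      unfolding A by (simp add: add_divide_distrib diff_divide_distrib)
    moreover have "2 * ((A - S) / (4 * k) + (A + S) / (4 * k)) = A / k" for k
      by (simp flip: add_divide_distrib)
    ultimately show "N / (1 - m) - 2 * m / (1 - m) + 2 * \<beta> * N / (1 - m)
        = 2 * ((A - S) / (4 * (1 - m)) + (A + S) / (4 * (1 - m)))" by (simp only:)
    have "1 / (2 * k) * a = 2 * (a / (4 * k))" for a k :: real by simp
    moreover have "gamma_exp 1 n m \<beta> = 1 / (2 * (1 - m)) * (A - S)" "gamma_exp 2 n m \<beta> = 1 / (2 * (1 - m)) * (A + S)"
      by (simp_all add: gamma_exp_def S_def A_def N_def)
    ultimately show "gamma_exp 1 n m \<beta> = 2 * ((A - S) / (4 * (1 - m)))" "gamma_exp 2 n m \<beta> = 2 * ((A + S) / (4 * (1 - m)))"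
      by (simp_all only:)
  qed
qed

section \<open>Assembly of the three cases\<close>

theorem theorem1p1:
  fixes n :: nat and m \<alpha> \<beta> :: real and f :: "real \<Rightarrow> real \<Rightarrow> real"
  assumes "n = CARD('n::finite)"
    and "n \<ge> 3"
    and "0 < m" and "m < (real n - 2) / real n"
    and "\<beta> > beta0 n m"
    and "\<alpha> = (2 * \<beta> + 1) / (1 - m)"
    and "\<And>lam. lam > 0 \<Longrightarrow> radial_solution TYPE('n) m \<alpha> \<beta> lam (f lam)"
  shows
    "((n \<ge> 3 \<and> 0 < m \<and> m < (real n - 2) / real n \<and> \<beta> > beta1 n m) \<or>
      (n > 4 \<and> 0 < m \<and> m < (real n - 4) / (real n - 2) \<and> beta0 n m < \<beta> \<and> \<beta> \<le> beta1 n m)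
      \<longrightarrow>
      (\<exists>B>0. \<forall>lam>0.
        decay_expansion n m (gamma_exp 1 n m \<beta>)
          (- (B * lam powr (- gamma_exp 1 n m \<beta>))) (f lam)))
     \<and>
     ((3 \<le> n \<and> n \<le> 4 \<and> 0 < m \<and> m < (real n - 2) / real n \<and>
        beta0 n m < \<beta> \<and> \<beta> < beta1 n m) \<or>
      (n > 4 \<and> (real n - 4) / (real n - 2) < m \<and> m < (real n - 2) / real n \<and>
        beta0 n m < \<beta> \<and> \<beta> < beta1 n m)
      \<longrightarrow>
      (\<exists>B>0. \<forall>lam>0.
        decay_expansion n m (gamma_exp 1 n m \<beta>)
          (B * lam powr (- gamma_exp 1 n m \<beta>)) (f lam)))
     \<and>
     ((3 \<le> n \<and> n \<le> 4 \<and> 0 < m \<and> m < (real n - 2) / real n \<and> \<beta> = beta1 n m) \<or>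
      (n > 4 \<and> (real n - 4) / (real n - 2) < m \<and> m < (real n - 2) / real n \<and> \<beta> = beta1 n m)
      \<longrightarrow>
      gamma_exp 2 n m (beta1 n m) = 2 \<and>
      (\<exists>B>0. \<forall>lam>0.
        decay_expansion n m (gamma_exp 2 n m (beta1 n m)) (- (B * lam powr (- 2))) (f lam)) \<and>
      (\<forall>lam>0. \<forall>y :: real ^ 'n.
        f lam (norm y) =
          (C_star n m / ((sqrt (C_star n m) / lam)\<^sup>2 + (norm y)\<^sup>2)) powr (1 / (1 - m))))"
proof -
  define N where "N = real n - 2 - real n * m"
  have n0: "real n > 0" and n3: "real n \<ge> 3" using assms(2) by simp_all
  have N: "N > 0" using assms(4) n0 by (simp add: N_def pos_less_divide_eq mult.commute)
  have "real n * m < real n * 1" using N by (simp add: N_def)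
  then have m: "0 < m" "m < 1" using assms(3) n0 by simp_all
  define p d \<kappa> C where "p = 2 * m / (1 - m)" and "d = N / (1 - m)" and "\<kappa> = 2 * \<beta> * N / (1 - m)" and "C = C_star n m"
  have C: "C > 0" using m N by (simp add: C_def C_star_def N_def)
  have "beta_e n m > 0" using m N by (simp add: beta_e_def N_def)
  then have \<beta>: "\<beta> > 0" and \<beta>2: "\<beta> > beta2 n m" using assms(5) by (auto simp: beta0_def)
  have p2: "p + 2 = 2 / (1 - m)" using m by (simp add: p_def field_simps)
  have kb: "\<kappa> = \<beta> * N * (p + 2)" by (simp add: \<kappa>_def p2)
  have p2pos: "p + 2 > 0" using m by (simp add: p2)
  \<comment> \<open>By \<open>\<kappa> = \<beta> * N * (p + 2)\<close>, comparing
    \<open>\<beta>\<close> with \<open>1 / N\<close> is comparing \<open>\<kappa>\<close> with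
    \<open>p + 2\<close>.\<close>
  have b1: "\<beta> > beta1 n m \<longleftrightarrow> \<kappa> > p + 2" "\<beta> < beta1 n m \<longleftrightarrow> \<kappa> < p + 2" "\<beta> = beta1 n m \<longleftrightarrow> \<kappa> = p + 2"
    unfolding beta1_def N_def[symmetric] kb
    using N p2pos mult_less_cancel_right[of 1 "p + 2" "\<beta> * N"] mult_less_cancel_right[of "\<beta> * N" "p + 2" 1]
    by (simp_all add: pos_less_divide_eq pos_divide_less_eq nonzero_eq_divide_eq)
  \<comment> \<open>\<open>(d - 2) * (1 - m) = (n - 4) - (n - 2) * m\<close>, so the threshold for
    \<open>m\<close> is \<open>d = 2\<close>, that is \<open>c1 * c2 = 1\<close>.\<close>
  have d2: "m < (real n - 4) / (real n - 2) \<longleftrightarrow> d > 2" "(real n - 4) / (real n - 2) < m \<longleftrightarrow> d < 2"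
    using m n3 unfolding d_def N_def by (auto simp: field_simps)
  have d4: "n \<le> 4 \<Longrightarrow> d < 2"
  proof -
    assume "n \<le> 4"
    then have "(real n - 4) / (real n - 2) \<le> 0" using n3 by (simp add: divide_nonpos_pos)
    then show "d < 2" using d2(2) m by linarith
  qed
  obtain c1 c2 where c: "0 < c1" "c1 < c2" "d = 2 * c1 * c2" "d - p + \<kappa> = 2 * (c1 + c2)"
    and g1: "gamma_exp 1 n m \<beta> = 2 * c1" and g2: "gamma_exp 2 n m \<beta> = 2 * c2"
    using node_roots[OF m _ \<beta>2] N unfolding d_def p_def \<kappa>_def N_def by blast
  define x where "x lam s = (exp s)\<^sup>2 * f lam (exp s) powr (1 - m) / C" for lam s
  have sys: "\<exists>\<zeta>. profile_system p d \<kappa> (lam\<^sup>2 / C) (x lam) \<zeta>" if lam: "lam > 0" for lam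
    using profile_system_of_solution[OF assms(1) m _ \<beta> assms(6) lam assms(7)[OF lam]] N
    unfolding p_def d_def \<kappa>_def C_def x_def[abs_def] N_def by blast
  have fpos: "f lam r > 0" if "lam > 0" "r \<ge> 0" for lam r
    using radial_solution_pos[OF assms(7)] that by blast
  have expand: "decay_expansion n m \<gamma> (- (b / (1 - m))) (f lam)"
    if "lam > 0" "\<gamma> > 0" "((\<lambda>s. (1 - x lam s) * exp (\<gamma> * s)) \<longlongrightarrow> b) at_top" for lam \<gamma> b
    using decay_expansion_of_tendsto[of m n "f lam" \<gamma> b] m C fpos that unfolding C_def x_def by simp
  \<comment> \<open>The orbit for \<open>lam = 1\<close> fixes the constant \<open>B\<close> in the
    first two cases; the other orbits are its translates.\<close>
  obtain \<zeta> where "profile_system p d \<kappa> (1\<^sup>2 / C) (x 1) \<zeta>" using sys[of 1] by auto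
  then have sys1: "profile_system p d \<kappa> (1 / C) (x 1) \<zeta>" by simp
  interpret profile_system p d \<kappa> "1 / C" "x 1" \<zeta> by (rule sys1)
  interpret node_profile p d \<kappa> "1 / C" "x 1" \<zeta> c1 c2 by unfold_locales (use c in auto)
  have expand1: "decay_expansion n m (2 * c1) (- (b / (1 - m) * lam powr - (2 * c1))) (f lam)"
    if lim: "((\<lambda>s. (1 - x 1 s) * exp (2 * c1 * s)) \<longlongrightarrow> b) at_top" and lam: "lam > 0" for b lam
  proof -
    obtain \<zeta>' where "profile_system p d \<kappa> (lam\<^sup>2 / C) (x lam) \<zeta>'" using sys[OF lam] by blast
    then have "profile_system p d \<kappa> (1 / C * lam\<^sup>2) (x lam) \<zeta>'" by simp
    from expand[OF lam _ ratio_of_translate[OF sys1 this lam lim]] c(1)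
    show ?thesis by simp
  qed
  have below: "\<exists>B>0. \<forall>lam>0. decay_expansion n m (gamma_exp 1 n m \<beta>) (- (B * lam powr (- gamma_exp 1 n m \<beta>))) (f lam)"
    if lim: "\<exists>B>0. ((\<lambda>s. (1 - x 1 s) * exp (2 * c1 * s)) \<longlongrightarrow> B) at_top"
  proof -
    obtain B where B: "B > 0" "((\<lambda>s. (1 - x 1 s) * exp (2 * c1 * s)) \<longlongrightarrow> B) at_top" using lim by blast
    show ?thesis unfolding g1
    proof (intro exI[of _ "B / (1 - m)"] conjI allI impI)
      show "decay_expansion n m (2 * c1) (- (B / (1 - m) * lam powr - (2 * c1))) (f lam)" if "lam > 0" for lam
        by (rule expand1[OF B(2) that])
    qed (use B m in auto)
  qed
  have a: "\<exists>B>0. \<forall>lam>0. decay_expansion n m (gamma_exp 1 n m \<beta>) (- (B * lam powr (- gamma_exp 1 n m \<beta>))) (f lam)"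
    if "\<beta> > beta1 n m \<or> (m < (real n - 4) / (real n - 2) \<and> \<beta> \<le> beta1 n m)"
  proof (rule below)
    show "\<exists>B>0. ((\<lambda>s. (1 - x 1 s) * exp (2 * c1 * s)) \<longlongrightarrow> B) at_top"
    proof (cases "\<kappa> > p + 2")
      case True
      then show ?thesis by (rule decay_from_below_if_large)
    next
      case False
      then show ?thesis using that b1(1) d2(1) by (intro decay_from_below_if_d_large) auto
    qed
  qed
  have b: "\<exists>B>0. \<forall>lam>0. decay_expansion n m (gamma_exp 1 n m \<beta>) (B * lam powr (- gamma_exp 1 n m \<beta>)) (f lam)"
    if d: "d < 2" and lt: "\<beta> < beta1 n m"
  proof -
    \<comment> \<open>Approach from \<open>x > 1\<close> makes the limit negative and hence the
      correction term positive.\<close>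
    obtain B where B: "B > 0" "((\<lambda>s. (1 - x 1 s) * exp (2 * c1 * s)) \<longlongrightarrow> - B) at_top"
      using decay_from_above[OF _ d] lt b1(2) by blast
    show ?thesis unfolding g1
    proof (intro exI[of _ "B / (1 - m)"] conjI allI impI)
      show "decay_expansion n m (2 * c1) (B / (1 - m) * lam powr - (2 * c1)) (f lam)" if "lam > 0" for lam
        using expand1[OF B(2) that] by simp
    qed (use B m in auto)
  qed
  have cc: "gamma_exp 2 n m (beta1 n m) = 2 \<and>
      (\<exists>B>0. \<forall>lam>0.
        decay_expansion n m (gamma_exp 2 n m (beta1 n m)) (- (B * lam powr (- 2))) (f lam)) \<and>
      (\<forall>lam>0. \<forall>y :: real ^ 'n.
        f lam (norm y) =
          (C_star n m / ((sqrt (C_star n m) / lam)\<^sup>2 + (norm y)\<^sup>2)) powr (1 / (1 - m)))"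
    if d: "d < 2" and beta: "\<beta> = beta1 n m"
  proof -
    have k: "\<kappa> = p + 2" using b1(3) beta by blast
    have "(1 - c1) * (1 - c2) = 0" using roots_at_1 k by simp
    \<comment> \<open>\<open>c1 = 1\<close> would give \<open>d = 2 * c2 > 2\<close>. So
      \<open>c2 = 1\<close>, and the orbit arrives along the fast direction.\<close>
    moreover have "c1 \<noteq> 1" using c d by auto
    ultimately have "c2 = 1" by simp
    then have \<gamma>: "gamma_exp 2 n m (beta1 n m) = 2" using g2 beta by simp
    have xeq: "x lam s = (exp s)\<^sup>2 / (C / lam\<^sup>2 + (exp s)\<^sup>2)" if lam: "lam > 0" for lam s
    proof -
      obtain \<zeta>' where s': "profile_system p d \<kappa> (lam\<^sup>2 / C) (x lam) \<zeta>'" using sys[OF lam] by blast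
      have e: "exp (2 * s) = (exp s)\<^sup>2" by (rule exp_double)
      have "lam\<^sup>2 / C * E / (1 + lam\<^sup>2 / C * E) = E / (C / lam\<^sup>2 + E)" if "E > 0" for E
      proof -
        have "lam\<^sup>2 / C * (C / lam\<^sup>2 + E) = 1 + lam\<^sup>2 / C * E" using lam C by (simp add: distrib_left)
        then have "lam\<^sup>2 / C * E / (1 + lam\<^sup>2 / C * E) = (lam\<^sup>2 / C * E) / (lam\<^sup>2 / C * (C / lam\<^sup>2 + E))" by simp
        also have "\<dots> = E / (C / lam\<^sup>2 + E)" using lam C by (intro mult_divide_mult_cancel_left) auto
        finally show ?thesis .
      qed
      then show ?thesis using profile_system.explicit_solution[OF s' k, of s] unfolding e by simp
    qed
    have ex: "f lam r = (C / ((sqrt C / lam)\<^sup>2 + r\<^sup>2)) powr (1 / (1 - m))" if lam: "lam > 0" and r: "r > 0" for lam r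
    proof -
      have "r\<^sup>2 * f lam r powr (1 - m) / C = r\<^sup>2 / (C / lam\<^sup>2 + r\<^sup>2)"
        using xeq[OF lam, of "ln r"] r by (simp add: x_def)
      moreover have "F = C / D" if "a * F / C = a / D" "a \<noteq> 0" for a F D
        using that C by (cases "D = 0") (simp_all add: field_simps)
      ultimately have "f lam r powr (1 - m) = C / (C / lam\<^sup>2 + r\<^sup>2)" using r by simp
      moreover have "(f lam r powr (1 - m)) powr (1 / (1 - m)) = f lam r"
        using fpos[OF lam, of r] r m by (simp add: powr_powr)
      ultimately show ?thesis using C by (simp add: power_divide)
    qed
    \<comment> \<open>The origin is not of the form \<open>exp s\<close>; there the formula is the
      prescribed value \<open>f lam 0\<close>.\<close>
    have ex0: "f lam 0 = (C / ((sqrt C / lam)\<^sup>2 + 0\<^sup>2)) powr (1 / (1 - m))" if lam: "lam > 0" for lam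
    proof -
      have "f lam 0 = (lam powr 2) powr (1 / (1 - m))"
        using assms(7)[OF lam] by (simp add: radial_solution_def powr_powr)
      moreover have "C / ((sqrt C / lam)\<^sup>2 + 0\<^sup>2) = lam powr 2" using C lam by (simp add: power_divide powr_numeral)
      ultimately show ?thesis by simp
    qed
    \<comment> \<open>With \<open>K = C / lam\<^sup>2\<close> and \<open>r = exp s\<close>,
      \<open>1 - x = K / (K + r\<^sup>2)\<close>, and multiplication by \<open>r\<^sup>2\<close>
      gives the limit \<open>K\<close>. Dividing by \<open>1 - m\<close> yields the constant
      \<open>B = C / (1 - m)\<close> used below.\<close>
    have lim: "((\<lambda>s. (1 - x lam s) * exp (2 * s)) \<longlongrightarrow> C / lam\<^sup>2) at_top" if lam: "lam > 0" for lam
    proof -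
      have "((\<lambda>s. inverse (exp s)) \<longlongrightarrow> (0::real)) at_top"
        by (rule tendsto_inverse_0_at_top[OF exp_at_top])
      then have "((\<lambda>s. C / lam\<^sup>2 / (C / lam\<^sup>2 * (inverse (exp s))\<^sup>2 + 1)) \<longlongrightarrow> C / lam\<^sup>2 / (C / lam\<^sup>2 * 0\<^sup>2 + 1)) at_top"
        by (intro tendsto_intros) auto
      moreover have "C / lam\<^sup>2 / (C / lam\<^sup>2 * (inverse (exp s))\<^sup>2 + 1) = (1 - x lam s) * exp (2 * s)" for s
      proof -
        have gen: "K / (K * (inverse E)\<^sup>2 + 1) = (1 - E\<^sup>2 / (K + E\<^sup>2)) * E\<^sup>2" if "K > 0" "E > 0" for K E :: real
        proof -
          have "K + E\<^sup>2 > 0" "K * (inverse E)\<^sup>2 + 1 > 0" using that by (auto intro!: add_pos_pos)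
          moreover have "K * (inverse E)\<^sup>2 + 1 = (K + E\<^sup>2) / E\<^sup>2"
            using that by (simp add: field_simps)
          ultimately show ?thesis using that by (simp add: field_simps)
        qed
        show ?thesis unfolding xeq[OF lam] exp_double using C lam by (intro gen) auto
      qed
      ultimately show ?thesis by simp
    qed
    show ?thesis unfolding \<gamma>
    proof (intro conjI exI[of _ "C / (1 - m)"] allI impI)
      fix lam :: real assume lam: "lam > 0"
      show "decay_expansion n m 2 (- (C / (1 - m) * lam powr - 2)) (f lam)"
        using expand[OF lam _ lim[OF lam]] lam by (simp add: powr_minus powr_numeral divide_inverse mult_ac)
      show "f lam (norm y) = (C_star n m / ((sqrt (C_star n m) / lam)\<^sup>2 + (norm y)\<^sup>2)) powr (1 / (1 - m))" for y :: "real ^ 'n"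
        using ex[OF lam, of "norm y"] ex0[OF lam] unfolding C_def by (cases "y = 0") auto
    qed (use C m in auto)
  qed
  show ?thesis using a b cc d2(2) d4 by blast
qed

end
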